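(* Let $m\ge 3$ and $n\ge 3$ (with $m\le\binom n2$). Then a generic algebra $\mathfrak n\in N(m,n)$ is rigid.
   Context: Work over $\mathbb R$ or $\mathbb C$. For a vector space $\mathfrak n_{-1}$ of dimension $n$ and $0\le m\le\binom n2$, $N(m,n)$ denotes the space of graded 2-step nilpotent Lie algebra structures $\mathfrak n=\mathfrak n_{-2}\oplus\mathfrak n_{-1}$ with $\dim\mathfrak n_{-2}=m$, where the bracket $\Lambda^2\mathfrak n_{-1}\to\mathfrak n_{-2}$ is surjective and $\mathfrak n_{-2}$ is central; it is identified with the Grassmannian $\operatorname{Gr}_d(\Lambda^2\mathfrak n_{-1})$, $d=\binom n2-m$, by associating to the bracket its kernel $Z\subset\Lambda^2\mathfrak n_{-1}$ (conversely $\mathfrak n_{-2}=\Lambda^2\mathfrak n_{-1}/Z$). "Generic" means: for $Z$ in a nonempty Zariski open subset of this Grassmannian. The Tanaka prolongation of $\mathfrak n$ is the maximal graded Lie algebra $\hat{\mathfrak n}=\bigoplus_{i\ge -2}\hat{\mathfrak n}_i$ with negative part equal to $\mathfrak n$ such that for $k\ge0$ any $X\in\hat{\mathfrak n}_k$ with $[X,\mathfrak n_{-1}]=0$ is zero; $\mathfrak n$ is rigid if $\hat{\mathfrak n}$ is finite dimensional. *)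

theory Defs
  imports Complex_Main "HOL-Library.Function_Algebras" "HOL-Library.Cardinality"
begin

text \<open>
  Conventions.  The ground field is a type 'k (instantiated by real and complex).
  The degree -1 part n_{-1} is the coordinate space 'n => 'k (dimension CARD('n)),
  the degree -2 part n_{-2} is 'm => 'k (dimension CARD('m)).
  A graded 2-step nilpotent structure is given by skew structure constants
  C a i j (a in 'm, i,j in 'n): [x,y] = sum_{i,j} C a i j x_i y_j (component a).
  Surjectivity of the induced map Lambda^2 n_{-1} -> n_{-2} is required; its kernel
  is Z = { z : sum_{i,j} z i j C a i j = 0 for all a }.
\<close>

definition bvec :: "'n \<Rightarrow> 'n \<Rightarrow> 'k::comm_ring_1" where
  "bvec i = (\<lambda>l. if l = i then 1 else 0)"

definition brk :: "('m \<Rightarrow> 'n::finite \<Rightarrow> 'n \<Rightarrow> 'k::field) \<Rightarrow> ('n \<Rightarrow> 'k) \<Rightarrow> ('n \<Rightarrow> 'k) \<Rightarrow> ('m \<Rightarrow> 'k)" where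
  "brk C x y = (\<lambda>a. \<Sum>i\<in>UNIV. \<Sum>j\<in>UNIV. C a i j * x i * y j)"

definition skew_const :: "('m \<Rightarrow> 'n \<Rightarrow> 'n \<Rightarrow> 'k::field) \<Rightarrow> bool" where
  "skew_const C \<longleftrightarrow> (\<forall>a i j. C a j i = - C a i j)"

definition surj_const :: "('m \<Rightarrow> 'n::finite \<Rightarrow> 'n \<Rightarrow> 'k::field) \<Rightarrow> bool" where
  "surj_const C \<longleftrightarrow> (\<forall>w::'m \<Rightarrow> 'k. \<exists>z::'n \<Rightarrow> 'n \<Rightarrow> 'k.
      \<forall>a. (\<Sum>i\<in>UNIV. \<Sum>j\<in>UNIV. z i j * C a i j) = w a)"

definition kerZ :: "('m \<Rightarrow> 'n::finite \<Rightarrow> 'n \<Rightarrow> 'k::field) \<Rightarrow> ('n \<Rightarrow> 'n \<Rightarrow> 'k) \<Rightarrow> bool" where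
  "kerZ C z \<longleftrightarrow> (\<forall>a. (\<Sum>i\<in>UNIV. \<Sum>j\<in>UNIV. z i j * C a i j) = 0)"

text \<open>
  Tanaka prolongation.  An element X of degree j-1 (j >= 0) is represented by its
  iterated action Phi(x_1,...,x_{j}) = [...[[X,x_1],x_2],...,x_j] in n_{-1}
  (Phi vanishes on lists of other lengths).  tanaka C j Phi says that Phi represents
  an element of the prolongation component of degree j-1.  Degree k >= 0 elements are
  X in Hom(g_{-1},g_{k-1}) + Hom(g_{-2},g_{k-2}) satisfying X[u,v] = [Xu,v] + [u,Xv]
  for u,v in n:  [X,x] in g_{k-1} (slice condition), the action on n_{-2} = Lambda^2/Z
  is well defined (vanishing of X[a,b] = [[X,a],b] - [[X,b],a] on Z), and the
  derivation rule for pairs in n_{-1} x n_{-2}: [[X,u],w] = [[X,w],u].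
\<close>

fun tan_well :: "('m \<Rightarrow> 'n::finite \<Rightarrow> 'n \<Rightarrow> 'k::field) \<Rightarrow> nat \<Rightarrow> (('n \<Rightarrow> 'k) list \<Rightarrow> ('n \<Rightarrow> 'k)) \<Rightarrow> bool" where
  "tan_well C 0 \<Phi> \<longleftrightarrow> (\<forall>z. kerZ C z \<longrightarrow>
      (\<lambda>a. \<Sum>i\<in>UNIV. \<Sum>j\<in>UNIV. z i j *
         (brk C (\<Phi> [bvec i]) (bvec j) a - brk C (\<Phi> [bvec j]) (bvec i) a)) = 0)"
| "tan_well C (Suc k) \<Phi> \<longleftrightarrow> (\<forall>z ws. kerZ C z \<longrightarrow>
      (\<lambda>l. \<Sum>i\<in>UNIV. \<Sum>j\<in>UNIV. z i j *
         (\<Phi> (bvec i # bvec j # ws) l - \<Phi> (bvec j # bvec i # ws) l)) = 0)"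

fun tan_jac :: "('m \<Rightarrow> 'n::finite \<Rightarrow> 'n \<Rightarrow> 'k::field) \<Rightarrow> nat \<Rightarrow> (('n \<Rightarrow> 'k) list \<Rightarrow> ('n \<Rightarrow> 'k)) \<Rightarrow> bool" where
  "tan_jac C 0 \<Phi> \<longleftrightarrow> True"
| "tan_jac C (Suc 0) \<Phi> \<longleftrightarrow> (\<forall>u a b.
      brk C (\<Phi> [u, a]) b - brk C (\<Phi> [u, b]) a = brk C (\<Phi> [a, b] - \<Phi> [b, a]) u)"
| "tan_jac C (Suc (Suc k)) \<Phi> \<longleftrightarrow> (\<forall>u a b ws.
      \<Phi> (u # a # b # ws) - \<Phi> (u # b # a # ws) = \<Phi> (a # b # u # ws) - \<Phi> (b # a # u # ws))"

fun tanaka :: "('m \<Rightarrow> 'n::finite \<Rightarrow> 'n \<Rightarrow> 'k::field) \<Rightarrow> nat \<Rightarrow> (('n \<Rightarrow> 'k) list \<Rightarrow> ('n \<Rightarrow> 'k)) \<Rightarrow> bool" where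
  "tanaka C 0 \<Phi> \<longleftrightarrow> (\<forall>ws. ws \<noteq> [] \<longrightarrow> \<Phi> ws = 0)"
| "tanaka C (Suc k) \<Phi> \<longleftrightarrow>
      (\<forall>ws. length ws \<noteq> Suc k \<longrightarrow> \<Phi> ws = 0) \<and>
      (\<forall>x y ws. \<Phi> ((x + y) # ws) = \<Phi> (x # ws) + \<Phi> (y # ws)) \<and>
      (\<forall>s x ws. \<Phi> ((\<lambda>i. s * x i) # ws) = (\<lambda>l. s * \<Phi> (x # ws) l)) \<and>
      (\<forall>x. tanaka C k (\<lambda>ws. \<Phi> (x # ws))) \<and>
      tan_well C k \<Phi> \<and> tan_jac C k \<Phi>"

text \<open>Rigid: the Tanaka prolongation is finite dimensional.  Every graded component
  (for degrees >= 0, indexed by j = degree + 1) is a subspace of a finite-dimensional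
  space of multilinear maps, so finite dimensionality of the whole prolongation means
  that only finitely many components are nonzero.\<close>
definition rigid :: "('m \<Rightarrow> 'n::finite \<Rightarrow> 'n \<Rightarrow> 'k::field) \<Rightarrow> bool" where
  "rigid C \<longleftrightarrow> finite {j. \<exists>\<Phi>. tanaka C j \<Phi> \<and> \<Phi> \<noteq> 0}"

inductive poly_fun :: "(('i \<Rightarrow> 'k::comm_ring_1) \<Rightarrow> 'k) \<Rightarrow> bool" where
  pf_const: "poly_fun (\<lambda>x. c)"
| pf_var: "poly_fun (\<lambda>x. x i)"
| pf_add: "poly_fun p \<Longrightarrow> poly_fun q \<Longrightarrow> poly_fun (\<lambda>x. p x + q x)"
| pf_mul: "poly_fun p \<Longrightarrow> poly_fun q \<Longrightarrow> poly_fun (\<lambda>x. p x * q x)"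

text \<open>A property Q holds for generic structures in N(m,n): there is a nonempty Zariski open
  set (the non-vanishing locus of a polynomial in the structure constants, intersected with
  the Zariski open set of surjective brackets) all of whose members satisfy Q.\<close>
definition generic :: "(('m \<Rightarrow> 'n::finite \<Rightarrow> 'n \<Rightarrow> 'k::field) \<Rightarrow> bool) \<Rightarrow> bool" where
  "generic Q \<longleftrightarrow> (\<exists>P :: ('m \<times> 'n \<times> 'n \<Rightarrow> 'k) \<Rightarrow> 'k. poly_fun P \<and>
      (\<exists>C. skew_const C \<and> surj_const C \<and> P (\<lambda>(a, i, j). C a i j) \<noteq> 0) \<and>
      (\<forall>C. skew_const C \<and> surj_const C \<and> P (\<lambda>(a, i, j). C a i j) \<noteq> 0 \<longrightarrow> Q C))"

end

theory Submission
  imports Defs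
begin

text \<open>
  The prolongation is finite dimensional as soon as the only symmetric bilinear \<open>F\<close> on
  \<open>n_{-1}\<close> with \<open>[F(x,a),b] = [F(x,b),a]\<close> is zero.  Indeed the action of \<open>n_{-2}\<close> lowers
  degrees by two and is then jointly injective in degrees \<open>\<ge> 1\<close>.  Impose \<open>[X,w] = 0\<close> for fewer
  and fewer \<open>w = [e_p,e_q]\<close>: if a single \<open>t = ad w\<close> is injective in high degrees, the
  dimensions stay bounded, so a nontrivial combination of the monomials \<open>t^{r-i} (ad e_p)^{2i}\<close>
  vanishes in all high degrees; commuting repeatedly with \<open>ad e_q\<close> differentiates it with respect
  to \<open>ad e_p\<close> until only a power of \<open>t\<close> is left, which is both zero and injective.

  The condition on \<open>F\<close> says that a linear system with coefficients polynomial in the structure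
  constants is injective, hence is Zariski open.  It holds for the structure on
  \<open>e_0, \<dots>, e_{n-1}\<close> whose first two components are the sums of \<open>e_p^* \<and> e_{p+1}^*\<close> over even
  and odd \<open>p\<close>, whose third is \<open>e_0^* \<and> e_{n-1}^*\<close>, and whose others are distinct
  \<open>e_p^* \<and> e_q^*\<close>.
\<close>

section \<open>Commuting operators on graded vector spaces\<close>

lemma homogeneous_system_nontrivial:
  fixes A :: "'e \<Rightarrow> 'u \<Rightarrow> 'k::field"
  assumes "finite E" "finite U" "card E < card U"
  shows "\<exists>c. (\<exists>u\<in>U. c u \<noteq> 0) \<and> (\<forall>e\<in>E. (\<Sum>u\<in>U. A e u * c u) = 0)"
  using assms
proof (induction E arbitrary: U A rule: finite_induct)
  case empty
  then obtain u where "u \<in> U" by fastforce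
  then show ?case by (intro exI[of _ "\<lambda>_. 1"]) auto
next
  case (insert e E)
  show ?case
  proof (cases "\<forall>u\<in>U. A e u = 0")
    case True
    have "card E < card U" using insert by simp
    from insert.IH[OF insert.prems(1) this, of A] True show ?thesis by (auto 4 4)
  next
    case False
    then obtain u where u: "u \<in> U" "A e u \<noteq> 0" by blast
    let ?V = "U - {u}"
    have "card E < card ?V" using insert u by simp
    from insert.IH[OF _ this, of "\<lambda>e' v. A e' v - A e' u * A e v / A e u"] insert.prems
    obtain c where c: "\<exists>v\<in>?V. c v \<noteq> 0"
      "\<And>e'. e' \<in> E \<Longrightarrow> (\<Sum>v\<in>?V. (A e' v - A e' u * A e v / A e u) * c v) = 0" by auto
    define s where "s = (\<Sum>v\<in>?V. A e v * c v)"
    \<comment> \<open>Back substitution: the solution \<open>c\<close> of the system with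
      \<open>u\<close> eliminated is extended by the value that equation \<open>e\<close> forces at
      the pivot \<open>u\<close>.\<close>
    define c' where "c' = c(u := - s / A e u)"
    have sum: "(\<Sum>v\<in>U. A e' v * c' v) = A e' u * (- s / A e u) + (\<Sum>v\<in>?V. A e' v * c v)" for e'
    proof -
      have "(\<Sum>v\<in>U. A e' v * c' v) = A e' u * c' u + (\<Sum>v\<in>?V. A e' v * c' v)"
        using u insert.prems by (simp add: sum.remove)
      also have "(\<Sum>v\<in>?V. A e' v * c' v) = (\<Sum>v\<in>?V. A e' v * c v)"
        by (rule sum.cong) (auto simp: c'_def)
      finally show ?thesis by (simp add: c'_def)
    qed
    have "(\<Sum>v\<in>U. A e' v * c' v) = 0" if e': "e' \<in> E" for e'
    proof -
      have "(\<Sum>v\<in>?V. (A e' v - A e' u * A e v / A e u) * c v)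
          = (\<Sum>v\<in>?V. A e' v * c v) - A e' u / A e u * s"
        unfolding s_def sum_distrib_left sum_subtractf[symmetric]
        by (rule sum.cong) (auto simp: field_simps)
      with c(2)[OF e'] show ?thesis unfolding sum by simp
    qed
    moreover have "(\<Sum>v\<in>U. A e v * c' v) = 0" unfolding sum using u by (simp add: s_def)
    moreover have "\<exists>v\<in>U. c' v \<noteq> 0" using c(1) by (auto simp: c'_def)
    ultimately show ?thesis by blast
  qed
qed

text \<open>Each functional costs at most one dimension: \<open>K\<close> is spanned by its
  intersection with the kernel of \<open>f\<close> together with one vector \<open>y\<close> on
  which \<open>f\<close> does not vanish.\<close>

lemma (in vector_space) separating_functionals_span:
  assumes "finite I" "subspace K" "\<And>f. f \<in> I \<Longrightarrow> Vector_Spaces.linear scale (*) f"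
    and "\<And>x. x \<in> K \<Longrightarrow> (\<And>f. f \<in> I \<Longrightarrow> f x = 0) \<Longrightarrow> x = 0"
  shows "\<exists>B. finite B \<and> card B \<le> card I \<and> B \<subseteq> K \<and> K \<subseteq> span B"
  using assms
proof (induction I arbitrary: K rule: finite_induct)
  case empty
  then show ?case by (intro exI[of _ "{}"]) auto
next
  case (insert f I)
  have f: "Vector_Spaces.linear scale (*) f" using insert by blast
  interpret f: Vector_Spaces.linear scale "(*)" f by (fact f)
  let ?K = "{x \<in> K. f x = 0}"
  have "subspace ?K" using insert.prems(1)
    by (auto simp: subspace_def f.add f.scale f.zero)
  then have "\<exists>B. finite B \<and> card B \<le> card I \<and> B \<subseteq> ?K \<and> ?K \<subseteq> span B"
    by (rule insert.IH) (use insert.prems in auto)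
  then obtain B where B: "finite B" "card B \<le> card I" "B \<subseteq> ?K" "?K \<subseteq> span B" by blast
  show ?case
  proof (cases "\<forall>x\<in>K. f x = 0")
    case True
    then show ?thesis using B insert by (intro exI[of _ B]) auto
  next
    case False
    then obtain y where y: "y \<in> K" "f y \<noteq> 0" by blast
    have "x \<in> span (insert y B)" if x: "x \<in> K" for x
    proof -
      have "x - scale (f x / f y) y \<in> ?K"
        using x y insert.prems(1) by (auto simp: subspace_diff subspace_scale f.diff f.scale)
      then have "x - scale (f x / f y) y \<in> span B" using B by blast
      then have "\<exists>k. x - scale k y \<in> span B" by blast
      then show ?thesis unfolding span_insert by simp
    qed
    moreover have "card (insert y B) \<le> card (insert f I)"
      using B insert by (simp add: card_insert_if)
    ultimately show ?thesis using B y by (intro exI[of _ "insert y B"]) auto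
  qed
qed

text \<open>A graded action of the Heisenberg algebra: \<open>t\<close> is the commutator of
  \<open>a\<close> and \<open>b\<close> and commutes with both. The finite separating sets
  \<open>I j\<close> express that each \<open>K j\<close> is finite dimensional. Degrees are
  truncated at 0.\<close>

locale graded_commutator = vector_space scale
  for scale :: "'k::field_char_0 \<Rightarrow> 'v::ab_group_add \<Rightarrow> 'v" (infixr "*s" 75) +
  fixes K :: "nat \<Rightarrow> 'v set" and a b t :: "'v \<Rightarrow> 'v" and I :: "nat \<Rightarrow> ('v \<Rightarrow> 'k) set"
  assumes subK: "subspace (K j)"
    and lina: "Vector_Spaces.linear scale scale a"
    and linb: "Vector_Spaces.linear scale scale b"
    and lint: "Vector_Spaces.linear scale scale t"
    and aK: "x \<in> K j \<Longrightarrow> a x \<in> K (j - 1)"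
    and bK: "x \<in> K j \<Longrightarrow> b x \<in> K (j - 1)"
    and tK: "x \<in> K j \<Longrightarrow> t x \<in> K (j - 2)"
    and comm: "x \<in> K j \<Longrightarrow> a (b x) = b (a x) + t x"
    and ta: "x \<in> K j \<Longrightarrow> t (a x) = a (t x)"
    and tb: "x \<in> K j \<Longrightarrow> t (b x) = b (t x)"
    and finI: "finite (I j)"
    and linI: "f \<in> I j \<Longrightarrow> Vector_Spaces.linear scale (*) f"
    and sepI: "x \<in> K j \<Longrightarrow> (\<And>f. f \<in> I j \<Longrightarrow> f x = 0) \<Longrightarrow> x = 0"
begin

interpretation a: Vector_Spaces.linear scale scale a by (fact lina)
interpretation b: Vector_Spaces.linear scale scale b by (fact linb)

lemma bpow_K: "x \<in> K j \<Longrightarrow> (b ^^ i) x \<in> K (j - i)"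
proof (induction i)
  case (Suc i) then show ?case using bK[of "(b ^^ i) x" "j - i"] by simp
qed simp

lemma tpow_K: "x \<in> K j \<Longrightarrow> (t ^^ i) x \<in> K (j - 2 * i)"
proof (induction i)
  case (Suc i) then show ?case using tK[of "(t ^^ i) x" "j - 2 * i"] by simp
qed simp

lemma tpow_b: "x \<in> K j \<Longrightarrow> (t ^^ i) (b x) = b ((t ^^ i) x)"
proof (induction i)
  case (Suc i)
  then show ?case using tb[OF tpow_K[OF Suc.prems]] by simp
qed simp

lemma tpow_a: "x \<in> K j \<Longrightarrow> (t ^^ i) (a x) = a ((t ^^ i) x)"
proof (induction i)
  case (Suc i)
  then show ?case using ta[OF tpow_K[OF Suc.prems]] by simp
qed simp

lemma tpow_bpow: "x \<in> K j \<Longrightarrow> (t ^^ i) ((b ^^ l) x) = (b ^^ l) ((t ^^ i) x)"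
proof (induction l)
  case (Suc l)
  then show ?case using tpow_b[OF bpow_K[OF Suc.prems]] by simp
qed simp

lemma tpow_linear: "Vector_Spaces.linear scale scale (t ^^ i)"
proof (induction i)
  case 0
  then show ?case by (simp add: linear_id[unfolded id_def] module_hom_id eq_id_iff id_def)
next
  case (Suc i)
  then show ?case using Vector_Spaces.linear_compose[OF Suc lint] by (simp add: comp_def)
qed

lemma bpow_linear: "Vector_Spaces.linear scale scale (b ^^ i)"
proof (induction i)
  case 0
  then show ?case by (simp add: linear_id[unfolded id_def] eq_id_iff id_def)
next
  case (Suc i)
  then show ?case using Vector_Spaces.linear_compose[OF Suc linb] by (simp add: comp_def)
qed

text \<open>Moving \<open>a\<close> past each of the \<open>i\<close> factors \<open>b\<close>
  leaves one central \<open>t\<close>. For \<open>i = 0\<close> the truncated exponent is harmless,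
  since its coefficient is 0.\<close>

lemma a_bpow: "x \<in> K j \<Longrightarrow> a ((b ^^ i) x) = (b ^^ i) (a x) + of_nat i *s t ((b ^^ (i - 1)) x)"
proof (induction i)
  case (Suc i)
  have "a ((b ^^ Suc i) x) = b (a ((b ^^ i) x)) + t ((b ^^ i) x)"
    using comm[OF bpow_K[OF Suc.prems]] by simp
  also have "b (a ((b ^^ i) x)) = (b ^^ Suc i) (a x) + of_nat i *s b (t ((b ^^ (i - 1)) x))"
    using Suc by (simp add: b.add b.scale)
  also have "b (t ((b ^^ (i - 1)) x)) = t (b ((b ^^ (i - 1)) x))"
    using tb[OF bpow_K[OF Suc.prems]] by simp
  also have "of_nat i *s \<dots> = of_nat i *s t ((b ^^ i) x)"
    by (cases i) auto
  finally show ?case by (simp add: scale_left_distrib add.assoc add.commute)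
qed simp

text \<open>The commutator with \<open>a\<close> acts on polynomials in \<open>b\<close> as
  \<open>t\<close> times the derivative. After \<open>p\<close> rounds only a power of
  \<open>t\<close> is left, and its coefficient is a multiple of \<open>c p\<close> that is nonzero
  in characteristic 0.\<close>

lemma tpow_zero_if_relation:
  assumes "\<And>j x. j \<ge> J \<Longrightarrow> x \<in> K j \<Longrightarrow> (\<Sum>i\<le>p. c i *s (t ^^ u i) ((b ^^ i) x)) = 0" "c p \<noteq> 0"
  shows "\<exists>s. \<forall>j\<ge>J + p. \<forall>x\<in>K j. (t ^^ s) x = 0"
  using assms
proof (induction p arbitrary: c u J)
  case 0
  then have "(t ^^ u 0) x = 0" if "j \<ge> J" "x \<in> K j" for j x
    using that by (fastforce simp: scale_eq_0_iff)
  then show ?case by auto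
next
  case (Suc p)
  define c' where "c' i = of_nat (Suc i) * c (Suc i)" for i
  define u' where "u' i = Suc (u (Suc i))" for i
  have "(\<Sum>i\<le>p. c' i *s (t ^^ u' i) ((b ^^ i) x)) = 0" if j: "j \<ge> Suc J" and x: "x \<in> K j" for j x
  proof -
    let ?R = "\<lambda>x. \<Sum>i\<le>Suc p. c i *s (t ^^ u i) ((b ^^ i) x)"
    \<comment> \<open>The relation is also used at \<open>a x\<close>, one degree lower, so the
      threshold grows by one in each round.\<close>
    have "?R x = 0" "?R (a x) = 0"
      using Suc.prems(1)[of j x] Suc.prems(1)[of "j - 1" "a x"] aK[OF x] j x by auto
    then have "0 = a (?R x) - ?R (a x)" by (simp only: a.zero diff_zero)
    also have "\<dots> = (\<Sum>i\<le>Suc p. c i *s (a ((t ^^ u i) ((b ^^ i) x)) - (t ^^ u i) ((b ^^ i) (a x))))"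
      by (simp only: a.sum a.scale sum_subtractf scale_right_diff_distrib)
    also have "\<dots> = (\<Sum>i\<le>Suc p. (of_nat i * c i) *s (t ^^ Suc (u i)) ((b ^^ (i - 1)) x))"
    proof (rule sum.cong[OF refl])
      fix i
      interpret tp: Vector_Spaces.linear scale scale "t ^^ u i" by (rule tpow_linear)
      have "a ((t ^^ u i) ((b ^^ i) x)) = (t ^^ u i) (a ((b ^^ i) x))"
        using tpow_a[OF bpow_K[OF x]] by simp
      also have "\<dots> = (t ^^ u i) ((b ^^ i) (a x)) + of_nat i *s (t ^^ Suc (u i)) ((b ^^ (i - 1)) x)"
        unfolding a_bpow[OF x] tp.add tp.scale funpow_Suc_right by simp
      finally show "c i *s (a ((t ^^ u i) ((b ^^ i) x)) - (t ^^ u i) ((b ^^ i) (a x)))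
          = (of_nat i * c i) *s (t ^^ Suc (u i)) ((b ^^ (i - 1)) x)"
        by (simp add: mult.commute)
    qed
    also have "\<dots> = (\<Sum>i\<le>p. c' i *s (t ^^ u' i) ((b ^^ i) x))"
      unfolding sum.atMost_Suc_shift by (simp add: c'_def u'_def del: funpow.simps)
    finally show ?thesis by simp
  qed
  moreover have "c' p \<noteq> 0" using Suc.prems(2) by (simp add: c'_def del: of_nat_Suc)
  ultimately have "\<exists>s. \<forall>j\<ge>Suc J + p. \<forall>x\<in>K j. (t ^^ s) x = 0" by (rule Suc.IH)
  then show ?case by simp
qed

section \<open>Relations among monomials in high degrees\<close>

lemma tpow_inj:
  assumes inj: "\<And>j x. j \<ge> N \<Longrightarrow> x \<in> K j \<Longrightarrow> t x = 0 \<Longrightarrow> x = 0"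
    and "x \<in> K j" "j \<ge> N + 2 * s" "(t ^^ s) x = 0"
  shows "x = 0"
  using assms(2-)
proof (induction s)
  case (Suc s)
  have "(t ^^ s) x = 0"
    using inj[OF _ tpow_K[OF Suc.prems(1), of s]] Suc.prems by simp
  then show ?case using Suc by simp
qed simp

text \<open>For even \<open>i \<le> 2 * r\<close> every such monomial lowers the degree by exactly
  \<open>2 * r\<close>, so linear combinations are homogeneous.\<close>

definition monom :: "nat \<Rightarrow> nat \<Rightarrow> 'v \<Rightarrow> 'v" where
  "monom r i x = (t ^^ (r - i div 2)) ((b ^^ i) x)"

lemma monom_linear: "Vector_Spaces.linear scale scale (monom r i)"
  unfolding monom_def using Vector_Spaces.linear_compose[OF bpow_linear tpow_linear] by (simp add: comp_def)

text \<open>A relation between operators from \<open>K j\<close> to \<open>K M\<close> needs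
  checking only on spanning vectors and separating functionals, which gives finitely many scalar
  equations.\<close>

lemma relation_on_span:
  assumes "K j \<subseteq> span B" "B \<subseteq> K j" "j = M + 2 * r"
    and "finite U" "\<And>i. i \<in> U \<Longrightarrow> even i \<and> i \<le> 2 * r"
    and rel: "\<And>x f. x \<in> B \<Longrightarrow> f \<in> I M \<Longrightarrow> (\<Sum>i\<in>U. f (monom r i x) * c i) = 0"
    and "x \<in> K j"
  shows "(\<Sum>i\<in>U. c i *s monom r i x) = 0"
proof -
  have RK: "monom r i x \<in> K M" if x: "x \<in> K j" and i: "i \<in> U" for x i
  proof -
    have "monom r i x \<in> K (j - i - 2 * (r - i div 2))"
      unfolding monom_def using x by (intro tpow_K bpow_K)
    moreover obtain h where "i = 2 * h" "h \<le> r" using assms(5)[OF i] by auto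
    ultimately show ?thesis using assms(3) by (simp add: diff_mult_distrib2)
  qed
  have B0: "(\<Sum>i\<in>U. c i *s monom r i x) = 0" if x: "x \<in> B" for x
  proof (rule sepI[of _ M])
    show "(\<Sum>i\<in>U. c i *s monom r i x) \<in> K M"
      using RK x assms(2) by (intro subspace_sum subspace_scale subK) auto
    fix f assume f: "f \<in> I M"
    interpret f: Vector_Spaces.linear scale "(*)" f by (rule linI[OF f])
    show "f (\<Sum>i\<in>U. c i *s monom r i x) = 0"
      using rel[OF x f] by (simp add: f.sum f.scale mult.commute)
  qed
  interpret Rl: Vector_Spaces.linear scale scale "monom r i" for i by (rule monom_linear)
  have "x \<in> span B" using assms by blast
  then show ?thesis
  proof (induction rule: span_induct_alt)
    case base
    show ?case by (simp add: Rl.zero)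
  next
    case (step s x y)
    have "(\<Sum>i\<in>U. c i *s monom r i (s *s x + y)) = s *s (\<Sum>i\<in>U. c i *s monom r i x) + (\<Sum>i\<in>U. c i *s monom r i y)"
      by (simp add: Rl.add Rl.scale scale_right_distrib scale_sum_right sum.distrib mult.commute)
    then show ?case using B0[OF step(1)] step by simp
  qed
qed

lemma eventually_zero:
  assumes inj: "\<And>j x. j \<ge> N \<Longrightarrow> x \<in> K j \<Longrightarrow> t x = 0 \<Longrightarrow> x = 0"
  shows "\<exists>N'. \<forall>j\<ge>N'. K j \<subseteq> {0}"
proof -
  \<comment> \<open>In degree \<open>M + 2 * r\<close> there are at most \<open>card (I M)\<close>
    spanning vectors, each giving \<open>card (I M)\<close> equations. The degrees
    \<open>M = N\<close> and \<open>M = Suc N\<close> are treated together, one for each parity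
    because \<open>t\<close> lowers degrees by two; so there are at most \<open>r\<close> equations
    for the \<open>r + 1\<close> even exponents in \<open>U\<close>.\<close>
  define r where "r = card (I N) * card (I N) + card (I (Suc N)) * card (I (Suc N))"
  have basis: "\<exists>B. finite B \<and> card B \<le> card (I M) \<and> B \<subseteq> K (M + 2 * r) \<and> K (M + 2 * r) \<subseteq> span B"
    if M: "M \<ge> N" for M
  proof -
    \<comment> \<open>The power \<open>t ^^ r\<close> embeds \<open>K (M + 2 * r)\<close> into
      \<open>K M\<close>, so the functionals of \<open>I M\<close> pulled back along it still
      separate points.\<close>
    let ?I = "(\<lambda>f. f \<circ> (t ^^ r)) ` I M"
    have "\<exists>B. finite B \<and> card B \<le> card ?I \<and> B \<subseteq> K (M + 2 * r) \<and> K (M + 2 * r) \<subseteq> span B"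
    proof (rule separating_functionals_span[OF _ subK])
      fix f assume "f \<in> ?I"
      then show "Vector_Spaces.linear scale (*) f"
        using Vector_Spaces.linear_compose[OF tpow_linear linI] by auto
    next
      fix x assume x: "x \<in> K (M + 2 * r)" and "\<And>f. f \<in> ?I \<Longrightarrow> f x = 0"
      then have z: "f ((t ^^ r) x) = 0" if "f \<in> I M" for f using that by fastforce
      have "(t ^^ r) x = 0" using tpow_K[OF x, of r] z by (intro sepI[of _ M]) auto
      then show "x = 0" using tpow_inj[where N = N and s = r, OF inj x] M by simp
    qed (simp add: finI)
    then show ?thesis using card_image_le[OF finI, of "\<lambda>f. f \<circ> (t ^^ r)" M] by (meson le_trans)
  qed
  obtain B0 where B0: "finite B0" "card B0 \<le> card (I N)" "B0 \<subseteq> K (N + 2 * r)" "K (N + 2 * r) \<subseteq> span B0"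
    using basis by blast
  obtain B1 where B1: "finite B1" "card B1 \<le> card (I (Suc N))" "B1 \<subseteq> K (Suc N + 2 * r)"
      "K (Suc N + 2 * r) \<subseteq> span B1"
    using basis[of "Suc N"] by auto
  define U where "U = (*) 2 ` {..r}"
  have U: "finite U" "card U = Suc r" "\<And>i. i \<in> U \<Longrightarrow> even i \<and> i \<le> 2 * r"
    unfolding U_def by (auto simp: card_image inj_on_def)
  define E where "E = (B0 \<times> I N) \<union> (B1 \<times> I (Suc N))"
  have "card E \<le> card (B0 \<times> I N) + card (B1 \<times> I (Suc N))" unfolding E_def by (rule card_Un_le)
  also have "\<dots> \<le> r" unfolding r_def card_cartesian_product using B0 B1 by (intro add_mono mult_mono) auto
  finally have "card E < card U" using U by simp
  moreover have "finite E" unfolding E_def using B0 B1 finI by simp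
  ultimately obtain c where c: "\<exists>i\<in>U. c i \<noteq> 0" "\<And>x f. (x, f) \<in> E \<Longrightarrow> (\<Sum>i\<in>U. f (monom r i x) * c i) = 0"
    using homogeneous_system_nontrivial[of E U "\<lambda>(x, f) i. f (monom r i x)"] U by fastforce
  have rel0: "(\<Sum>i\<in>U. c i *s monom r i x) = 0" if "x \<in> K (N + 2 * r)" for x
    by (rule relation_on_span[OF B0(4,3) refl U(1) U(3)]) (use c that U in \<open>auto simp: E_def\<close>)
  have rel1: "(\<Sum>i\<in>U. c i *s monom r i x) = 0" if "x \<in> K (Suc N + 2 * r)" for x
    by (rule relation_on_span[OF B1(4,3) refl U(1) U(3)]) (use c that U in \<open>auto simp: E_def\<close>)
  text \<open>A suitable power of \<open>t\<close> brings every higher degree down to these two injectively.\<close>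
  have rel: "(\<Sum>i\<in>U. c i *s monom r i x) = 0" if j: "j \<ge> N + 2 * r" and x: "x \<in> K j" for j x
  proof -
    define q where "q = (j - (N + 2 * r)) div 2"
    interpret tq: Vector_Spaces.linear scale scale "t ^^ q" by (rule tpow_linear)
    have "j - 2 * q = N + 2 * r \<or> j - 2 * q = Suc N + 2 * r"
      using j unfolding q_def by presburger
    then have "(\<Sum>i\<in>U. c i *s monom r i ((t ^^ q) x)) = 0"
      using tpow_K[OF x, of q] rel0 rel1 by metis
    moreover have "monom r i ((t ^^ q) x) = (t ^^ q) (monom r i x)" for i
      unfolding monom_def tpow_bpow[OF x, symmetric] by (metis comp_apply funpow_add add.commute)
    ultimately have z: "(t ^^ q) (\<Sum>i\<in>U. c i *s monom r i x) = 0"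
      by (simp add: tq.sum tq.scale)
    have jr: "j - 2 * r \<ge> N + 2 * q" using j unfolding q_def by presburger
    have "monom r i x \<in> K (j - 2 * r)" if i: "i \<in> U" for i
    proof -
      obtain h where h: "i = 2 * h" "h \<le> r" using U(3)[OF i] by auto
      have "monom r i x \<in> K (j - i - 2 * (r - i div 2))"
        unfolding monom_def using x by (intro tpow_K bpow_K)
      then show ?thesis using h j by (simp add: algebra_simps diff_mult_distrib2)
    qed
    then have "(\<Sum>i\<in>U. c i *s monom r i x) \<in> K (j - 2 * r)"
      by (intro subspace_sum subspace_scale subK)
    from tpow_inj[OF inj this jr z] show ?thesis by simp
  qed
  define p where "p = Max {i \<in> U. c i \<noteq> 0}"
  have p: "p \<in> U" "c p \<noteq> 0" "\<And>i. i \<in> U \<Longrightarrow> c i \<noteq> 0 \<Longrightarrow> i \<le> p"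
  proof -
    have "p \<in> {i \<in> U. c i \<noteq> 0}" unfolding p_def using U(1) c(1) by (intro Max_in) auto
    then show "p \<in> U" "c p \<noteq> 0" by auto
    show "\<And>i. i \<in> U \<Longrightarrow> c i \<noteq> 0 \<Longrightarrow> i \<le> p" unfolding p_def using U(1) by (intro Max_ge) auto
  qed
  \<comment> \<open>Odd exponents get coefficient 0, so that the relation becomes a sum over all
    \<open>i \<le> p\<close>.\<close>
  define c' where "c' i = (if i \<in> U then c i else 0)" for i
  define u where "u i = r - i div 2" for i
  have rel': "(\<Sum>i\<le>p. c' i *s (t ^^ u i) ((b ^^ i) x)) = 0" if "j \<ge> N + 2 * r" "x \<in> K j" for j x
  proof -
    have "(\<Sum>i\<le>p. c' i *s (t ^^ u i) ((b ^^ i) x)) = (\<Sum>i\<in>U. c i *s monom r i x)"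
      unfolding monom_def u_def by (rule sum.mono_neutral_cong) (use U(1) p in \<open>auto simp: c'_def\<close>)
    then show ?thesis using rel that by simp
  qed
  have "c' p \<noteq> 0" using p by (simp add: c'_def)
  from tpow_zero_if_relation[where J = "N + 2 * r" and c = c' and p = p and u = u, OF rel' this]
  have "\<exists>s. \<forall>j\<ge>N + 2 * r + p. \<forall>x\<in>K j. (t ^^ s) x = 0" .
  then obtain s where s: "\<And>j x. j \<ge> N + 2 * r + p \<Longrightarrow> x \<in> K j \<Longrightarrow> (t ^^ s) x = 0"
    by blast
  show ?thesis
  proof (intro exI allI impI subsetI)
    \<comment> \<open>The extra \<open>2 * s\<close> keeps all \<open>s\<close> applications of
      \<open>t\<close> within the degrees where it is injective.\<close>
    fix j x assume "j \<ge> N + 2 * r + p + 2 * s" "x \<in> K j"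
    then show "x \<in> {0}" using tpow_inj[where N = N and s = s, OF inj] s[of j x] by simp
  qed
qed

end

section \<open>Nondegenerate brackets are rigid\<close>

definition scl :: "'k::field \<Rightarrow> ('w \<Rightarrow> 'n \<Rightarrow> 'k) \<Rightarrow> 'w \<Rightarrow> 'n \<Rightarrow> 'k" where
  "scl c \<Phi> = (\<lambda>ws l. c * \<Phi> ws l)"

lemma vector_space_scl: "vector_space scl"
  by unfold_locales (auto simp: scl_def algebra_simps plus_fun_def)

lemma linear_sclI:
  assumes "\<And>x y. f (x + y) = f x + f y" "\<And>c x. f (scl c x) = scl c (f x)"
  shows "Vector_Spaces.linear scl scl f"
  using assms by (simp add: Vector_Spaces.linear_iff vector_space_scl)

lemma linear_scl_coord: "Vector_Spaces.linear scl (*) (\<lambda>\<Phi> :: 'w \<Rightarrow> 'n \<Rightarrow> 'k::field. \<Phi> ws l)"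
proof -
  have "vector_space ((*) :: 'k \<Rightarrow> 'k \<Rightarrow> 'k)" by unfold_locales (simp_all add: algebra_simps)
  then show ?thesis by (simp add: Vector_Spaces.linear_iff vector_space_scl) (simp add: scl_def)
qed

text \<open>If \<open>\<Phi>\<close> represents \<open>X\<close>, this represents
  \<open>[X,x]\<close>.\<close>

definition slice :: "'x \<Rightarrow> ('x list \<Rightarrow> 'n \<Rightarrow> 'k) \<Rightarrow> 'x list \<Rightarrow> 'n \<Rightarrow> 'k" where
  "slice x \<Phi> = (\<lambda>ws. \<Phi> (x # ws))"

text \<open>By the Jacobi identity this represents \<open>[X,[e_p,e_q]]\<close>, the action of an
  element of \<open>n_{-2}\<close>.\<close>

definition commut :: "'n \<Rightarrow> 'n \<Rightarrow> (('n \<Rightarrow> 'k::field) list \<Rightarrow> 'n \<Rightarrow> 'k) \<Rightarrow> ('n \<Rightarrow> 'k) list \<Rightarrow> 'n \<Rightarrow> 'k" where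
  "commut p q \<Phi> = slice (bvec q) (slice (bvec p) \<Phi>) - slice (bvec p) (slice (bvec q) \<Phi>)"

lemma commut_apply: "commut p q \<Phi> ws = \<Phi> (bvec p # bvec q # ws) - \<Phi> (bvec q # bvec p # ws)"
  by (simp add: commut_def slice_def)

lemma slice_zero [simp]: "slice x 0 = 0" and slice_add: "slice x (\<Phi> + \<Psi>) = slice x \<Phi> + slice x \<Psi>"
  and slice_scl: "slice x (scl c \<Phi>) = scl c (slice x \<Phi>)"
  by (auto simp: slice_def scl_def fun_eq_iff)

lemma commut_zero [simp]: "commut p q 0 = 0" and commut_add: "commut p q (\<Phi> + \<Psi>) = commut p q \<Phi> + commut p q \<Psi>"
  and commut_scl: "commut p q (scl c \<Phi>) = scl c (commut p q \<Phi>)"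
  by (auto simp: commut_apply scl_def algebra_simps fun_eq_iff)

lemma brk_add: "brk C (x + y) z a = brk C x z a + brk C y z a"
  by (simp add: brk_def algebra_simps sum.distrib)

lemma brk_diff: "brk C (x - y) z a = brk C x z a - brk C y z a"
  by (simp add: brk_def algebra_simps sum_subtractf)

lemma brk_scale: "brk C (\<lambda>l. c * x l) z a = c * brk C x z a"
  by (simp add: brk_def sum_distrib_left algebra_simps)

lemma tan_well_add: "tan_well C k \<Phi> \<Longrightarrow> tan_well C k \<Psi> \<Longrightarrow> tan_well C k (\<Phi> + \<Psi>)"
proof (cases k)
  case 0
  assume "tan_well C k \<Phi>" "tan_well C k \<Psi>"
  moreover have "z i j * (brk C ((\<Phi> + \<Psi>) [bvec i]) (bvec j) a - brk C ((\<Phi> + \<Psi>) [bvec j]) (bvec i) a)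
    = z i j * (brk C (\<Phi> [bvec i]) (bvec j) a - brk C (\<Phi> [bvec j]) (bvec i) a)
    + z i j * (brk C (\<Psi> [bvec i]) (bvec j) a - brk C (\<Psi> [bvec j]) (bvec i) a)" for z i j a
    by (simp add: brk_add algebra_simps)
  ultimately show ?thesis using 0 by (simp add: fun_eq_iff sum.distrib del: plus_fun_apply)
next
  case (Suc k')
  assume "tan_well C k \<Phi>" "tan_well C k \<Psi>"
  moreover have "z i j * ((\<Phi> + \<Psi>) (bvec i # bvec j # ws) l - (\<Phi> + \<Psi>) (bvec j # bvec i # ws) l)
    = z i j * (\<Phi> (bvec i # bvec j # ws) l - \<Phi> (bvec j # bvec i # ws) l)
    + z i j * (\<Psi> (bvec i # bvec j # ws) l - \<Psi> (bvec j # bvec i # ws) l)" for z i j l ws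
    by (simp add: algebra_simps)
  ultimately show ?thesis using Suc by (simp add: fun_eq_iff sum.distrib del: plus_fun_apply)
qed

lemma tan_well_scl: "tan_well C k \<Phi> \<Longrightarrow> tan_well C k (scl c \<Phi>)"
proof (cases k)
  case 0
  assume "tan_well C k \<Phi>"
  moreover have "z i j * (brk C (scl c \<Phi> [bvec i]) (bvec j) a - brk C (scl c \<Phi> [bvec j]) (bvec i) a)
    = c * (z i j * (brk C (\<Phi> [bvec i]) (bvec j) a - brk C (\<Phi> [bvec j]) (bvec i) a))" for z i j a
    unfolding scl_def brk_scale by (simp only: algebra_simps)
  ultimately show ?thesis using 0
    by (simp only: tan_well.simps fun_eq_iff sum_distrib_left[symmetric] zero_fun_apply) simp
next
  case (Suc k')
  assume "tan_well C k \<Phi>"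
  moreover have "z i j * (scl c \<Phi> (bvec i # bvec j # ws) l - scl c \<Phi> (bvec j # bvec i # ws) l)
    = c * (z i j * (\<Phi> (bvec i # bvec j # ws) l - \<Phi> (bvec j # bvec i # ws) l))" for z i j l ws
    unfolding scl_def by (simp only: algebra_simps)
  ultimately show ?thesis using Suc
    by (simp only: tan_well.simps fun_eq_iff sum_distrib_left[symmetric] zero_fun_apply) simp
qed

lemma tan_jac_add: "tan_jac C k \<Phi> \<Longrightarrow> tan_jac C k \<Psi> \<Longrightarrow> tan_jac C k (\<Phi> + \<Psi>)"
proof (induction C k \<Phi> rule: tan_jac.induct)
  case (2 C \<Phi>)
  show ?case unfolding tan_jac.simps fun_eq_iff
  proof (intro allI)
    fix u a b x
    have "(brk C (\<Phi> [u, a]) b - brk C (\<Phi> [u, b]) a) x = brk C (\<Phi> [a, b] - \<Phi> [b, a]) u x"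
      "(brk C (\<Psi> [u, a]) b - brk C (\<Psi> [u, b]) a) x = brk C (\<Psi> [a, b] - \<Psi> [b, a]) u x"
      using 2 by (simp_all only: tan_jac.simps)
    then have "brk C (\<Phi> [u, a]) b x - brk C (\<Phi> [u, b]) a x = brk C (\<Phi> [a, b]) u x - brk C (\<Phi> [b, a]) u x"
      "brk C (\<Psi> [u, a]) b x - brk C (\<Psi> [u, b]) a x = brk C (\<Psi> [a, b]) u x - brk C (\<Psi> [b, a]) u x"
      by (simp_all only: minus_apply brk_diff)
    then show "(brk C ((\<Phi> + \<Psi>) [u, a]) b - brk C ((\<Phi> + \<Psi>) [u, b]) a) x
        = brk C ((\<Phi> + \<Psi>) [a, b] - (\<Phi> + \<Psi>) [b, a]) u x"
      by (simp only: minus_apply plus_fun_apply brk_diff brk_add add_diff_add)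
  qed
next
  case (3 C k \<Phi>)
  show ?case unfolding tan_jac.simps
  proof (intro allI)
    fix u a b ws
    have "\<Phi> (u # a # b # ws) - \<Phi> (u # b # a # ws) = \<Phi> (a # b # u # ws) - \<Phi> (b # a # u # ws)"
      "\<Psi> (u # a # b # ws) - \<Psi> (u # b # a # ws) = \<Psi> (a # b # u # ws) - \<Psi> (b # a # u # ws)"
      by (rule 3(1)[unfolded tan_jac.simps, rule_format], rule 3(2)[unfolded tan_jac.simps, rule_format])
    then show "(\<Phi> + \<Psi>) (u # a # b # ws) - (\<Phi> + \<Psi>) (u # b # a # ws)
        = (\<Phi> + \<Psi>) (a # b # u # ws) - (\<Phi> + \<Psi>) (b # a # u # ws)"
      by (simp only: plus_fun_apply add_diff_add)
  qed
qed simp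

lemma tan_jac_scl: "tan_jac C k \<Phi> \<Longrightarrow> tan_jac C k (scl c \<Phi>)"
proof (induction C k \<Phi> rule: tan_jac.induct)
  case (2 C \<Phi>)
  show ?case unfolding tan_jac.simps fun_eq_iff
  proof (intro allI)
    fix u a b x
    have "(brk C (\<Phi> [u, a]) b - brk C (\<Phi> [u, b]) a) x = brk C (\<Phi> [a, b] - \<Phi> [b, a]) u x"
      using 2 by (simp_all only: tan_jac.simps)
    then have "c * (brk C (\<Phi> [u, a]) b x - brk C (\<Phi> [u, b]) a x)
        = c * (brk C (\<Phi> [a, b]) u x - brk C (\<Phi> [b, a]) u x)"
      by (simp add: brk_diff)
    then show "(brk C (scl c \<Phi> [u, a]) b - brk C (scl c \<Phi> [u, b]) a) x
        = brk C (scl c \<Phi> [a, b] - scl c \<Phi> [b, a]) u x"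
      unfolding fun_diff_def[of "brk _ _ _"] brk_diff scl_def brk_scale by (simp only: right_diff_distrib)
  qed
next
  case (3 C k \<Phi>)
  show ?case unfolding tan_jac.simps fun_eq_iff
  proof (intro allI)
    fix u a b ws x
    have "(\<Phi> (u # a # b # ws) - \<Phi> (u # b # a # ws)) x = (\<Phi> (a # b # u # ws) - \<Phi> (b # a # u # ws)) x"
      using 3 by (simp only: tan_jac.simps)
    then have "c * (\<Phi> (u # a # b # ws) x - \<Phi> (u # b # a # ws) x)
        = c * (\<Phi> (a # b # u # ws) x - \<Phi> (b # a # u # ws) x)"
      by simp
    then show "(scl c \<Phi> (u # a # b # ws) - scl c \<Phi> (u # b # a # ws)) x
        = (scl c \<Phi> (a # b # u # ws) - scl c \<Phi> (b # a # u # ws)) x"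
      by (simp only: scl_def fun_diff_def right_diff_distrib)
  qed
qed simp

lemma tanaka_well: "tanaka C (Suc j) \<Phi> \<Longrightarrow> tan_well C j \<Phi>"
  by (subst (asm) tanaka.simps(2)) (elim conjE)

lemma tanaka_jac: "tanaka C (Suc j) \<Phi> \<Longrightarrow> tan_jac C j \<Phi>"
  by (subst (asm) tanaka.simps(2)) (elim conjE)

lemma tanaka_scl: "tanaka C j \<Phi> \<Longrightarrow> tanaka C j (scl c \<Phi>)"
proof (induction j arbitrary: \<Phi>)
  case (Suc j)
  note \<Phi> = Suc.prems[unfolded tanaka.simps]
  have sl: "(\<lambda>ws. scl c \<Phi> (x # ws)) = scl c (\<lambda>ws. \<Phi> (x # ws))" for x
    by (auto simp: scl_def)
  show ?case unfolding tanaka.simps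
  proof (intro conjI allI impI)
    show "scl c \<Phi> ws = 0" if "length ws \<noteq> Suc j" for ws
      using \<Phi> that by (auto simp: scl_def)
    show "scl c \<Phi> ((x + y) # ws) = scl c \<Phi> (x # ws) + scl c \<Phi> (y # ws)" for x y ws
      using \<Phi> by (simp add: scl_def fun_eq_iff algebra_simps)
    show "scl c \<Phi> ((\<lambda>i. s * x i) # ws) = (\<lambda>l. s * scl c \<Phi> (x # ws) l)" for s x ws
      using \<Phi> by (simp add: scl_def fun_eq_iff mult.left_commute)
    show "tanaka C j (\<lambda>ws. scl c \<Phi> (x # ws))" for x
      unfolding sl using \<Phi> Suc.IH by blast
    show "tan_well C j (scl c \<Phi>)" by (rule tan_well_scl[OF tanaka_well[OF Suc.prems]])
    show "tan_jac C j (scl c \<Phi>)" by (rule tan_jac_scl[OF tanaka_jac[OF Suc.prems]])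
  qed
qed (auto simp: scl_def)

lemma tanaka_add: "tanaka C j \<Phi> \<Longrightarrow> tanaka C j \<Psi> \<Longrightarrow> tanaka C j (\<Phi> + \<Psi>)"
proof (induction j arbitrary: \<Phi> \<Psi>)
  case (Suc j)
  note \<Phi> = Suc.prems[unfolded tanaka.simps]
  have sl: "(\<lambda>ws. (\<Phi> + \<Psi>) (x # ws)) = (\<lambda>ws. \<Phi> (x # ws)) + (\<lambda>ws. \<Psi> (x # ws))" for x
    by (simp add: fun_eq_iff)
  show ?case unfolding tanaka.simps
  proof (intro conjI allI impI)
    show "(\<Phi> + \<Psi>) ws = 0" if "length ws \<noteq> Suc j" for ws
      using \<Phi> that by auto
    show "(\<Phi> + \<Psi>) ((x + y) # ws) = (\<Phi> + \<Psi>) (x # ws) + (\<Phi> + \<Psi>) (y # ws)" for x y ws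
      using \<Phi> by (simp add: fun_eq_iff algebra_simps)
    show "(\<Phi> + \<Psi>) ((\<lambda>i. s * x i) # ws) = (\<lambda>l. s * (\<Phi> + \<Psi>) (x # ws) l)" for s x ws
      using \<Phi> by (simp add: fun_eq_iff algebra_simps)
    show "tanaka C j (\<lambda>ws. (\<Phi> + \<Psi>) (x # ws))" for x
      unfolding sl using \<Phi> Suc.IH by blast
    show "tan_well C j (\<Phi> + \<Psi>)" using Suc.prems by (intro tan_well_add tanaka_well)
    show "tan_jac C j (\<Phi> + \<Psi>)" using Suc.prems by (intro tan_jac_add tanaka_jac)
  qed
qed auto

lemma tanaka_zero:
  fixes C :: "'m \<Rightarrow> 'n::finite \<Rightarrow> 'n \<Rightarrow> 'k::field"
  shows "tanaka C j 0"
proof (induction j)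
  case (Suc j)
  have "tan_jac C j 0"
  proof (cases j)
    case (Suc k)
    then show ?thesis by (cases k) (auto simp: brk_def fun_eq_iff)
  qed simp
  moreover have "tan_well C j 0" by (cases j) (auto simp: brk_def fun_eq_iff)
  moreover have "(\<lambda>ws. (0 :: ('n \<Rightarrow> 'k) list \<Rightarrow> 'n \<Rightarrow> 'k) (x # ws)) = 0" for x
    by (simp add: fun_eq_iff)
  ultimately show ?case using Suc by (simp add: fun_eq_iff zero_fun_def)
qed auto

section \<open>Brackets with \<open>n_{-1}\<close> and \<open>n_{-2}\<close> on the
  prolongation\<close>

lemma tanaka_vanish: "tanaka C j \<Phi> \<Longrightarrow> length ws \<noteq> j \<Longrightarrow> \<Phi> ws = 0"
  by (cases j) auto

lemma tanaka_slice: "tanaka C j \<Phi> \<Longrightarrow> tanaka C (j - 1) (slice x \<Phi>)"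
  by (cases j) (auto simp: slice_def)

text \<open>The actions of \<open>n_{-1}\<close> and \<open>n_{-2}\<close> commute because
  \<open>n_{-2}\<close> is central in \<open>n\<close>; in this encoding that is the derivation rule
  \<open>tan_jac\<close>.\<close>

lemma tanaka_commut_slice:
  assumes "tanaka C j \<Phi>"
  shows "commut p q (slice x \<Phi>) = slice x (commut p q \<Phi>)"
proof (cases "j \<le> 2")
  case True
  \<comment> \<open>Here both sides evaluate \<open>\<Phi>\<close> only on lists of length at least
    3, where it vanishes.\<close>
  have "\<Phi> (u # v # w # ws) = 0" for u v w ws
    using assms True by (intro tanaka_vanish) auto
  then show ?thesis by (auto simp: commut_apply slice_def fun_eq_iff)
next
  case False
  then obtain k where "j = 3 + k" using le_Suc_ex[of 3 j] by auto
  then have "tanaka C (Suc (Suc (Suc k))) \<Phi>" using assms by (simp add: numeral_3_eq_3 del: tanaka.simps)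
  then have jac: "tan_jac C (Suc (Suc k)) \<Phi>" by (rule tanaka_jac)
  show ?thesis
  proof
    fix ws
    show "commut p q (slice x \<Phi>) ws = slice x (commut p q \<Phi>) ws"
      unfolding commut_apply slice_def by (rule jac[unfolded tan_jac.simps, rule_format])
  qed
qed

lemma tanaka_zero_if_basis_slices:
  assumes "tanaka C (Suc j) \<Phi>" "\<And>i. slice (bvec i) \<Phi> = 0"
  shows "\<Phi> = 0"
proof -
  have add: "\<Phi> ((x + y) # ws) = \<Phi> (x # ws) + \<Phi> (y # ws)"
    and sc: "\<Phi> ((\<lambda>i. s * x i) # ws) = (\<lambda>l. s * \<Phi> (x # ws) l)" for s x y ws
    using assms(1) by auto
  have z: "\<Phi> (0 # ws) = 0" for ws using add[of 0 0 ws] by simp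
  have b: "\<Phi> (bvec i # ws) = 0" for i ws using assms(2)[of i] by (auto simp: slice_def fun_eq_iff)
  \<comment> \<open>The first argument is assembled one coordinate at a time, each step using its
    additivity and homogeneity.\<close>
  have "\<Phi> ((\<lambda>l. if l \<in> S then x l else 0) # ws) = 0" for S x ws
  proof (induction S rule: infinite_finite_induct)
    case (insert i S)
    have "(\<lambda>l. if l \<in> insert i S then x l else 0) = (\<lambda>l. if l \<in> S then x l else 0) + (\<lambda>l. x i * bvec i l)"
      using insert by (auto simp: bvec_def fun_eq_iff)
    then show ?case using insert by (simp only: add sc b) auto
  qed (use z in \<open>auto simp: zero_fun_def\<close>)
  from this[of UNIV] have c: "\<Phi> (x # ws) = 0" for x ws by simp
  have "\<Phi> ws = 0" for ws using c tanaka_vanish[OF assms(1), of "[]"] by (cases ws) auto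
  then show ?thesis by auto
qed

text \<open>This makes each component finite dimensional: there are finitely many lists of basis
  vectors of a given length.\<close>

lemma tanaka_zero_if_coords:
  assumes "tanaka C j \<Phi>" "\<And>is l. length is = j \<Longrightarrow> \<Phi> (map bvec is) l = 0"
  shows "\<Phi> = 0"
  using assms
proof (induction j arbitrary: \<Phi>)
  case 0
  then have "\<Phi> ws = 0" for ws by (cases ws) (auto simp: fun_eq_iff)
  then show ?case by auto
next
  case (Suc j)
  show ?case
  proof (rule tanaka_zero_if_basis_slices[OF Suc.prems(1)])
    fix i
    show "slice (bvec i) \<Phi> = 0"
    proof (rule Suc.IH)
      show "tanaka C j (slice (bvec i) \<Phi>)" using tanaka_slice[OF Suc.prems(1)] by simp
      fix "is" :: "'b list" and l assume "length is = j"
      then show "slice (bvec i) \<Phi> (map bvec is) l = 0"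
        using Suc.prems(2)[of "i # is"] by (simp add: slice_def)
    qed
  qed
qed

declare tanaka.simps [simp del]

text \<open>\<open>F i j l\<close> is the \<open>l\<close>-th coordinate of
  \<open>F(e_i,e_j)\<close>, and the second condition reads
  \<open>[F(e_i,e_j),e_k] = [F(e_i,e_k),e_j]\<close>. Such an \<open>F\<close> is a degree-one
  element of the prolongation on which \<open>n_{-2}\<close> acts trivially.\<close>

definition nondeg :: "('m \<Rightarrow> 'n::finite \<Rightarrow> 'n \<Rightarrow> 'k::field) \<Rightarrow> bool" where
  "nondeg C \<longleftrightarrow> (\<forall>F. (\<forall>i j l. F i j l = F j i l) \<longrightarrow>
     (\<forall>c i j k. (\<Sum>l\<in>UNIV. C c l k * F i j l) = (\<Sum>l\<in>UNIV. C c l j * F i k l)) \<longrightarrow>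
     (\<forall>i j l. F i j l = 0))"

lemma brk_bvec: "brk C x (bvec k) c = (\<Sum>l\<in>UNIV. C c l k * x l)"
  by (simp add: brk_def bvec_def if_distrib[of "\<lambda>t. _ * t"] cong: if_cong)

text \<open>In degree one this is nondegeneracy. In higher degrees the slices are again killed by
  \<open>n_{-2}\<close>, hence zero by induction, and an element whose basis slices vanish is
  zero.\<close>

lemma tanaka_commut_kernel:
  assumes "nondeg C" "tanaka C (Suc (Suc j)) \<Phi>" "\<And>p q. commut p q \<Phi> = 0"
  shows "\<Phi> = 0"
  using assms(2,3)
proof (induction j arbitrary: \<Phi>)
  case 0
  define F where "F i j = \<Phi> [bvec i, bvec j]" for i j
  have sym: "F i j = F j i" for i j
    using fun_cong[OF fun_cong[OF 0(2)[of i j], of "[]"]] by (simp add: F_def commut_apply fun_eq_iff)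
  have jac: "tan_jac C (Suc 0) \<Phi>" by (rule tanaka_jac[OF 0(1)])
  have "brk C (F i j) (bvec k) - brk C (F i k) (bvec j) = brk C (F j k - F k j) (bvec i)" for i j k
    unfolding F_def by (rule jac[unfolded tan_jac.simps, rule_format])
  moreover have "brk C (F j k - F k j) (bvec i) = 0" for i j k
    by (subst sym[of j k]) (simp add: brk_def fun_eq_iff)
  ultimately have "brk C (F i j) (bvec k) = brk C (F i k) (bvec j)" for i j k
    by (metis right_minus_eq)
  then have eq: "(\<Sum>l\<in>UNIV. C c l k * F i j l) = (\<Sum>l\<in>UNIV. C c l j * F i k l)" for c i j k
    unfolding brk_bvec[symmetric] by simp
  have "F i j l = 0" for i j l
    by (rule assms(1)[unfolded nondeg_def, rule_format]) (rule fun_cong[OF sym], rule eq)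
  then show ?case
    by (intro tanaka_zero_if_coords[OF 0(1)]) (auto simp: F_def length_Suc_conv)
next
  case (Suc j)
  show ?case
  proof (rule tanaka_zero_if_basis_slices[OF Suc.prems(1)])
    fix i
    show "slice (bvec i) \<Phi> = 0"
    proof (rule Suc.IH)
      show "tanaka C (Suc (Suc j)) (slice (bvec i) \<Phi>)"
        using tanaka_slice[OF Suc.prems(1), of "bvec i"] by simp
      show "commut p q (slice (bvec i) \<Phi>) = 0" for p q
        unfolding tanaka_commut_slice[OF Suc.prems(1)] Suc.prems(2) by (rule slice_zero)
    qed
  qed
qed

lemma rigid_if_nondeg:
  fixes C :: "'m \<Rightarrow> 'n::finite \<Rightarrow> 'n \<Rightarrow> 'k::field_char_0"
  assumes "nondeg C"
  shows "rigid C"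
proof -
  interpret V: vector_space "scl :: 'k \<Rightarrow> (('n \<Rightarrow> 'k) list \<Rightarrow> 'n \<Rightarrow> 'k) \<Rightarrow> _"
    by (rule vector_space_scl)
  define K where "K S j = {\<Phi>. tanaka C j \<Phi> \<and> (\<forall>p q. (p, q) \<in> S \<longrightarrow> commut p q \<Phi> = 0)}" for S j
  have sliceK: "slice x \<Phi> \<in> K S (j - 1)" if "\<Phi> \<in> K S j" for x \<Phi> S j
    using that tanaka_slice[of C j \<Phi> x] by (auto simp: K_def tanaka_commut_slice)
  have subK: "V.subspace (K S j)" for S j
    unfolding V.subspace_def
    by (auto simp: K_def tanaka_zero tanaka_add tanaka_scl commut_add commut_scl)
  have diffK: "\<Phi> - \<Psi> \<in> K S j" if "\<Phi> \<in> K S j" "\<Psi> \<in> K S j" for \<Phi> \<Psi> S j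
    using V.subspace_diff[OF subK that] .
  \<comment> \<open>On \<open>K S\<close> the kernel of \<open>t = commut p q\<close> is
    \<open>K (insert (p, q) S)\<close>. If that vanishes in high degrees, \<open>t\<close> is
    injective there and \<open>eventually_zero\<close> applies.\<close>
  have step: "\<exists>N'. \<forall>j\<ge>N'. K S j \<subseteq> {0}"
    if IH: "\<forall>j\<ge>N. K (insert (p, q) S) j \<subseteq> {0}" for S N p q
  proof -
    let ?I = "\<lambda>j. (\<lambda>(is :: 'n list, l) (\<Phi> :: ('n \<Rightarrow> 'k) list \<Rightarrow> 'n \<Rightarrow> 'k). \<Phi> (map bvec is) l) ` ({is. length is = j} \<times> UNIV)"
    interpret graded_commutator scl "K S" "slice (bvec q)" "slice (bvec p)" "commut p q" ?I
    proof (intro graded_commutator.intro graded_commutator_axioms.intro)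
      show "finite (?I j)" for j
        using finite_lists_length_eq[of "UNIV :: 'n set" j] by (intro finite_imageI finite_cartesian_product) auto
      show "Vector_Spaces.linear scl (*) f" if f: "f \<in> ?I j" for f j
      proof -
        obtain "is" :: "'n list" and l :: 'n where "f = (\<lambda>\<Phi>. \<Phi> (map bvec is) l)" using f by auto
        then show ?thesis by (simp only: linear_scl_coord)
      qed
      show "\<Phi> = 0" if "\<Phi> \<in> K S j" "\<And>f. f \<in> ?I j \<Longrightarrow> f \<Phi> = 0" for \<Phi> j
      proof (rule tanaka_zero_if_coords)
        show "tanaka C j \<Phi>" using that(1) by (simp add: K_def)
        fix "is" :: "'n list" and l assume "length is = j"
        then have "(\<lambda>\<Phi>. \<Phi> (map bvec is) l) \<in> ?I j" by (intro image_eqI[of _ _ "(is, l)"]) auto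
        then show "\<Phi> (map bvec is) l = 0" by (rule that(2))
      qed
      show "commut p q \<Phi> \<in> K S (j - 2)" if "\<Phi> \<in> K S j" for \<Phi> j
      proof -
        have "slice x (slice y \<Phi>) \<in> K S (j - 2)" for x y
          using sliceK[OF sliceK[OF that], of x y] by (simp only: diff_diff_left one_add_one)
        then show ?thesis unfolding commut_def by (intro diffK)
      qed
      show "commut p q (slice (bvec q) \<Phi>) = slice (bvec q) (commut p q \<Phi>)"
        "commut p q (slice (bvec p) \<Phi>) = slice (bvec p) (commut p q \<Phi>)" if "\<Phi> \<in> K S j" for \<Phi> j
        using that tanaka_commut_slice unfolding K_def by blast+
      show "slice (bvec q) (slice (bvec p) \<Phi>) = slice (bvec p) (slice (bvec q) \<Phi>) + commut p q \<Phi>"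
        if "\<Phi> \<in> K S j" for \<Phi> j
        unfolding commut_def by (simp only: add_diff_eq add_diff_cancel_left')
      show "Vector_Spaces.linear scl scl (slice (bvec q))" "Vector_Spaces.linear scl scl (slice (bvec p))"
        by (rule linear_sclI; rule slice_add slice_scl)+
      show "Vector_Spaces.linear scl scl (commut p q)"
        by (rule linear_sclI) (rule commut_add commut_scl)+
      show "vector_space (scl :: 'k \<Rightarrow> (('n \<Rightarrow> 'k) list \<Rightarrow> 'n \<Rightarrow> 'k) \<Rightarrow> _)" by (rule vector_space_scl)
      show "V.subspace (K S j)" for j by (rule subK)
      show "slice (bvec q) \<Phi> \<in> K S (j - 1)" "slice (bvec p) \<Phi> \<in> K S (j - 1)"
        if "\<Phi> \<in> K S j" for \<Phi> j
        by (rule sliceK[OF that])+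
    qed
    have "\<Phi> = 0" if "j \<ge> N" "\<Phi> \<in> K S j" "commut p q \<Phi> = 0" for j \<Phi>
    proof -
      have "\<Phi> \<in> K (insert (p, q) S) j" using that(2,3) unfolding K_def by simp
      then show ?thesis using IH that(1) by blast
    qed
    then show ?thesis by (rule eventually_zero)
  qed
  \<comment> \<open>Induction on the set \<open>A\<close> of dropped constraints. With none dropped,
    all of \<open>n_{-2}\<close> acts trivially; with all dropped, \<open>K {} j\<close> is the
    whole component.\<close>
  have "\<exists>N. \<forall>j\<ge>N. K (UNIV - A) j \<subseteq> {0}" for A
  proof (induction A rule: infinite_finite_induct)
    case empty
    have "K UNIV j \<subseteq> {0}" if j: "j \<ge> 2" for j
    proof -
      obtain i where "j = Suc (Suc i)" using le_Suc_ex[OF j] by auto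
      then have "\<Phi> = 0" if "\<Phi> \<in> K UNIV j" for \<Phi>
      proof -
        have "tanaka C (Suc (Suc i)) \<Phi>" "commut p q \<Phi> = 0" for p q
          using that by (simp_all add: K_def \<open>j = Suc (Suc i)\<close>)
        then show ?thesis by (rule tanaka_commut_kernel[OF assms])
      qed
      then show ?thesis by blast
    qed
    then show ?case unfolding Diff_empty by blast
  next
    case (insert x A)
    from insert.hyps have "UNIV - A = insert (fst x, snd x) (UNIV - insert x A)" by auto
    with insert.IH obtain N where "\<forall>j\<ge>N. K (insert (fst x, snd x) (UNIV - insert x A)) j \<subseteq> {0}"
      by (elim exE) (simp only:)
    then show ?case by (rule step)
  qed (simp add: finite)
  from this[of UNIV] obtain N where N: "\<And>j. j \<ge> N \<Longrightarrow> K {} j \<subseteq> {0}"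
    unfolding Diff_cancel by blast
  have "j < N" if "tanaka C j \<Phi>" "\<Phi> \<noteq> 0" for j \<Phi>

  proof (rule ccontr)
    assume "\<not> j < N"
    then have "K {} j \<subseteq> {0}" by (intro N) simp
    moreover have "\<Phi> \<in> K {} j" using that by (simp add: K_def)
    ultimately show False using that(2) by blast
  qed
  then have "{j. \<exists>\<Phi>. tanaka C j \<Phi> \<and> \<Phi> \<noteq> 0} \<subseteq> {..<N}" by auto
  then show ?thesis unfolding rigid_def by (rule finite_subset) simp
qed

section \<open>Nondegeneracy is an open condition\<close>

lemma poly_fun_diff: "poly_fun p \<Longrightarrow> poly_fun q \<Longrightarrow> poly_fun (\<lambda>x. p x - q x)"
  using pf_add[OF _ pf_mul[OF pf_const[of "- 1"]], of p q] by simp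

text \<open>Fraction-free Gaussian elimination: cross-multiplying with a pivot equation
  \<open>g\<close> keeps coefficients polynomial, and \<open>P\<close> is the product of the pivots
  met, each nonzero at \<open>x0\<close>.\<close>

lemma injective_system_open:
  fixes A :: "('u \<Rightarrow> ('i \<Rightarrow> 'k::field) \<Rightarrow> 'k) set"
  assumes "finite U" "\<And>f u. f \<in> A \<Longrightarrow> poly_fun (f u)"
    and "\<And>c. (\<And>f. f \<in> A \<Longrightarrow> (\<Sum>u\<in>U. f u x0 * c u) = 0) \<Longrightarrow> (\<forall>u\<in>U. c u = 0)"
  shows "\<exists>P. poly_fun P \<and> P x0 \<noteq> 0 \<and> (\<forall>x. P x \<noteq> 0 \<longrightarrow>
    (\<forall>c. (\<forall>f\<in>A. (\<Sum>u\<in>U. f u x * c u) = 0) \<longrightarrow> (\<forall>u\<in>U. c u = 0)))"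
  using assms
proof (induction U arbitrary: A rule: finite_induct)
  case empty
  show ?case by (intro exI[of _ "\<lambda>_. 1"]) (auto intro: pf_const)
next
  case (insert w U)
  have "\<exists>f\<in>A. f w x0 \<noteq> 0"
  proof (rule ccontr)
    assume "\<not> ?thesis"
    \<comment> \<open>Without a pivot in column \<open>w\<close>, the indicator of \<open>w\<close>
      would be a nontrivial solution at \<open>x0\<close>.\<close>
    then have "\<forall>u\<in>insert w U. (if u = w then 1 else 0 :: 'k) = 0"
      using insert.hyps by (intro insert.prems(2)) (auto simp: sum.neutral)
    then show False by simp
  qed
  then obtain g where g: "g \<in> A" "g w x0 \<noteq> 0" by blast
  define E where "E f u x = g w x * f u x - f w x * g u x" for f :: "'u \<Rightarrow> ('i \<Rightarrow> 'k) \<Rightarrow> 'k" and u x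
  have E_sum: "(\<Sum>u\<in>U. E f u x * c u)
      = g w x * (\<Sum>u\<in>insert w U. f u x * c u) - f w x * (\<Sum>u\<in>insert w U. g u x * c u)" for f c x
    using insert.hyps
    by (simp add: E_def sum_distrib_left sum_subtractf algebra_simps)
  have "\<exists>P. poly_fun P \<and> P x0 \<noteq> 0 \<and> (\<forall>x. P x \<noteq> 0 \<longrightarrow>
    (\<forall>c. (\<forall>f\<in>E ` A. (\<Sum>u\<in>U. f u x * c u) = 0) \<longrightarrow> (\<forall>u\<in>U. c u = 0)))"
  proof (rule insert.IH)
    show "poly_fun (f u)" if f: "f \<in> E ` A" for f u
    proof -
      obtain h where h: "h \<in> A" "f = E h" using f by blast
      have "poly_fun (\<lambda>x. g w x * h u x - h w x * g u x)"
        using insert.prems(1) g h(1) by (intro poly_fun_diff pf_mul)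
      then show ?thesis unfolding h(2) E_def .
    qed
    fix c :: "'u \<Rightarrow> 'k"
    assume c: "\<And>f. f \<in> E ` A \<Longrightarrow> (\<Sum>u\<in>U. f u x0 * c u) = 0"
    \<comment> \<open>The value at \<open>w\<close> is chosen to satisfy the pivot equation, so a
      solution of the reduced system lifts to one of the full system.\<close>
    define c' where "c' = c(w := - (\<Sum>u\<in>U. g u x0 * c u) / g w x0)"
    have cc: "(\<Sum>u\<in>U. f u x0 * c' u) = (\<Sum>u\<in>U. f u x0 * c u)" for f :: "'u \<Rightarrow> ('i \<Rightarrow> 'k) \<Rightarrow> 'k"
      using insert.hyps by (intro sum.cong) (auto simp: c'_def)
    have gz: "(\<Sum>u\<in>insert w U. g u x0 * c' u) = 0"
      using insert.hyps g(2) by (simp add: cc) (simp add: c'_def)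
    have "(\<Sum>u\<in>insert w U. f u x0 * c' u) = 0" if "f \<in> A" for f
    proof -
      have "(\<Sum>u\<in>U. E f u x0 * c' u) = 0" using c that by (subst cc) blast
      then show ?thesis unfolding E_sum gz using g(2) by simp
    qed
    then have "\<forall>u\<in>insert w U. c' u = 0" by (rule insert.prems(2))
    then show "\<forall>u\<in>U. c u = 0" using insert.hyps by (auto simp: c'_def split: if_splits)
  qed
  then obtain P where P: "poly_fun P" "P x0 \<noteq> 0"
    "\<And>x c. P x \<noteq> 0 \<Longrightarrow> \<forall>f\<in>A. (\<Sum>u\<in>U. E f u x * c u) = 0 \<Longrightarrow> \<forall>u\<in>U. c u = 0"
    by auto
  show ?case
  proof (intro exI[of _ "\<lambda>x. P x * g w x"] conjI allI impI)
    show "poly_fun (\<lambda>x. P x * g w x)" using P(1) insert.prems(1) g(1) by (intro pf_mul)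
    show "P x0 * g w x0 \<noteq> 0" using P g by simp
    fix x c assume x: "P x * g w x \<noteq> 0" and c: "\<forall>f\<in>A. (\<Sum>u\<in>insert w U. f u x * c u) = 0"
    have "\<forall>u\<in>U. c u = 0" using x c g(1) by (intro P(3)[of x]) (auto simp only: E_sum mult_zero_right diff_self mult_eq_0_iff)
    moreover have "(\<Sum>u\<in>insert w U. g u x * c u) = 0" using c g(1) by blast
    ultimately show "\<forall>u\<in>insert w U. c u = 0" using x insert.hyps by simp
  qed
qed

text \<open>The unknown with index \<open>(p, q, l)\<close> stands for \<open>F p q l\<close>; the
  argument \<open>x\<close> holds the structure constants, on which the symmetry equations do not
  depend.\<close>

definition sym_eq :: "'n \<Rightarrow> 'n \<Rightarrow> 'n \<Rightarrow> 'n \<times> 'n \<times> 'n \<Rightarrow> ('m \<times> 'n \<times> 'n \<Rightarrow> 'k::field) \<Rightarrow> 'k" where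
  "sym_eq i j l = (\<lambda>u x. (if u = (i, j, l) then 1 else 0) - (if u = (j, i, l) then 1 else 0))"

definition brk_eq :: "'m \<Rightarrow> 'n \<Rightarrow> 'n \<Rightarrow> 'n \<Rightarrow> 'n \<times> 'n \<times> 'n \<Rightarrow> ('m \<times> 'n \<times> 'n \<Rightarrow> 'k::field) \<Rightarrow> 'k" where
  "brk_eq a i j k = (\<lambda>(p, q, l) x. (if (p, q) = (i, j) then x (a, l, k) else 0)
      - (if (p, q) = (i, k) then x (a, l, j) else 0))"

text \<open>The condition \<^const>\<open>nondeg\<close> says that the linear system with these coefficient
  families, evaluated at the structure constants, has only the trivial solution.\<close>
definition nondeg_eqs :: "('n \<times> 'n \<times> 'n \<Rightarrow> ('m \<times> 'n \<times> 'n \<Rightarrow> 'k::field) \<Rightarrow> 'k) set" where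
  "nondeg_eqs = {sym_eq i j l | i j l. True} \<union> {brk_eq a i j k | a i j k. True}"

lemma ball_nondeg_eqs:
  "(\<forall>f\<in>nondeg_eqs. Q f) \<longleftrightarrow> (\<forall>i j l. Q (sym_eq i j l)) \<and> (\<forall>a i j k. Q (brk_eq a i j k))"
  unfolding nondeg_eqs_def by blast

lemma poly_fun_nondeg_eqs: "\<forall>f\<in>nondeg_eqs. poly_fun (f u)"
  unfolding ball_nondeg_eqs
proof (intro conjI allI)
  show "poly_fun (sym_eq i j l u)" for i j l
    unfolding sym_eq_def by (rule pf_const)
  have *: "poly_fun (\<lambda>x. if b then x v else 0)" for b v
    by (cases b) (simp_all add: pf_var pf_const)
  obtain p q l where u: "u = (p, q, l)" by (cases u)
  show "poly_fun (brk_eq a i j k u)" for a i j k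
    unfolding brk_eq_def u prod.case by (intro poly_fun_diff *)
qed

lemma sum_triple_delta:
  fixes g :: "'n::finite \<Rightarrow> 'k::field" and c :: "'n \<times> 'n \<times> 'n \<Rightarrow> 'k"
  shows "(\<Sum>(p, q, l)\<in>UNIV. (if (p, q) = (i, j) then g l else 0) * c (p, q, l)) = (\<Sum>l\<in>UNIV. g l * c (i, j, l))"
proof -
  have "(\<Sum>(p, q, l)\<in>UNIV. (if (p, q) = (i, j) then g l else 0) * c (p, q, l))
      = (\<Sum>(p, q, l)\<in>(\<lambda>l. (i, j, l)) ` UNIV. g l * c (p, q, l))"
    by (rule sum.mono_neutral_cong_right) auto
  also have "\<dots> = (\<Sum>l\<in>UNIV. g l * c (i, j, l))"
    by (subst sum.reindex) (auto simp: inj_on_def)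
  finally show ?thesis .
qed

lemma nondeg_iff_eqs:
  fixes C :: "'m \<Rightarrow> 'n::finite \<Rightarrow> 'n \<Rightarrow> 'k::field"
  shows "nondeg C \<longleftrightarrow> (\<forall>c. (\<forall>f\<in>nondeg_eqs. (\<Sum>u\<in>UNIV. f u (\<lambda>(a, i, j). C a i j) * c u) = 0) \<longrightarrow> (\<forall>u\<in>UNIV. c u = 0))"
proof -
  let ?x = "\<lambda>(a, i, j). C a i j"
  have sym: "(\<Sum>u\<in>UNIV. sym_eq i j l u ?x * c u) = c (i, j, l) - c (j, i, l)"
    for c :: "'n \<times> 'n \<times> 'n \<Rightarrow> 'k" and i j l
    by (simp add: sym_eq_def left_diff_distrib sum_subtractf if_distrib[of "\<lambda>t. t * _"] cong: if_cong)
  have br: "(\<Sum>u\<in>UNIV. brk_eq a i j k u ?x * c u)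
      = (\<Sum>l\<in>UNIV. C a l k * c (i, j, l)) - (\<Sum>l\<in>UNIV. C a l j * c (i, k, l))"
    for c :: "'n \<times> 'n \<times> 'n \<Rightarrow> 'k" and a i j k
  proof -
    have "(\<Sum>u\<in>UNIV. brk_eq a i j k u ?x * c u)
      = (\<Sum>(p, q, l)\<in>UNIV. (if (p, q) = (i, j) then C a l k else 0) * c (p, q, l))
        - (\<Sum>(p, q, l)\<in>UNIV. (if (p, q) = (i, k) then C a l j else 0) * c (p, q, l))"
      unfolding sum_subtractf[symmetric] brk_eq_def
      by (rule sum.cong) (auto simp: algebra_simps split: if_splits)
    then show ?thesis
      unfolding sum_triple_delta[of i j "\<lambda>l. C a l k" c] sum_triple_delta[of i k "\<lambda>l. C a l j" c] .
  qed
  have eqs: "(\<forall>f\<in>nondeg_eqs. (\<Sum>u\<in>UNIV. f u ?x * c u) = 0) \<longleftrightarrow>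
      (\<forall>i j l. c (i, j, l) = c (j, i, l)) \<and>
      (\<forall>a i j k. (\<Sum>l\<in>UNIV. C a l k * c (i, j, l)) = (\<Sum>l\<in>UNIV. C a l j * c (i, k, l)))"
    for c :: "'n \<times> 'n \<times> 'n \<Rightarrow> 'k"
    unfolding ball_nondeg_eqs sym br right_minus_eq ..
  show ?thesis unfolding eqs
  proof (intro iffI allI impI ballI)
    fix c :: "'n \<times> 'n \<times> 'n \<Rightarrow> 'k" and u :: "'n \<times> 'n \<times> 'n"
    assume n: "nondeg C" and c: "(\<forall>i j l. c (i, j, l) = c (j, i, l)) \<and>
      (\<forall>a i j k. (\<Sum>l\<in>UNIV. C a l k * c (i, j, l)) = (\<Sum>l\<in>UNIV. C a l j * c (i, k, l)))"
    obtain i j l where u: "u = (i, j, l)" by (cases u)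
    show "c u = 0" unfolding u
      by (rule n[unfolded nondeg_def, rule_format, of "\<lambda>i j l. c (i, j, l)"])
        (rule c[THEN conjunct1, rule_format], rule c[THEN conjunct2, rule_format])
  next
    assume *: "\<forall>c. (\<forall>i j l. c (i, j, l) = c (j, i, l)) \<and>
      (\<forall>a i j k. (\<Sum>l\<in>UNIV. C a l k * c (i, j, l)) = (\<Sum>l\<in>UNIV. C a l j * c (i, k, l)))
       \<longrightarrow> (\<forall>u\<in>UNIV. c u = 0)"
    show "nondeg C" unfolding nondeg_def
    proof (intro allI impI)
      fix F :: "'n \<Rightarrow> 'n \<Rightarrow> 'n \<Rightarrow> 'k" and i j l
      assume "\<forall>i j l. F i j l = F j i l"
        "\<forall>c i j k. (\<Sum>l\<in>UNIV. C c l k * F i j l) = (\<Sum>l\<in>UNIV. C c l j * F i k l)"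
      then show "F i j l = 0"
        using *[rule_format, of "\<lambda>(i, j, l). F i j l" "(i, j, l)"] by simp
    qed
  qed
qed

text \<open>Nondegeneracy holds wherever \<open>P\<close> does not vanish, and \<open>C0\<close>
  witnesses that this open set is nonempty.\<close>

lemma generic_rigid_if_nondeg:
  fixes C0 :: "'m \<Rightarrow> 'n::finite \<Rightarrow> 'n \<Rightarrow> 'k::field_char_0"
  assumes "skew_const C0" "surj_const C0" "nondeg C0"
  shows "generic (rigid :: ('m \<Rightarrow> 'n \<Rightarrow> 'n \<Rightarrow> 'k) \<Rightarrow> bool)"
proof -
  have "\<exists>P. poly_fun P \<and> P (\<lambda>(a, i, j). C0 a i j) \<noteq> 0 \<and> (\<forall>x :: 'm \<times> 'n \<times> 'n \<Rightarrow> 'k. P x \<noteq> 0 \<longrightarrow>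
    (\<forall>c. (\<forall>f\<in>nondeg_eqs. (\<Sum>u\<in>UNIV. f u x * c u) = 0) \<longrightarrow> (\<forall>u\<in>UNIV. c u = 0)))"
  proof (rule injective_system_open)
    show "\<And>f u. f \<in> nondeg_eqs \<Longrightarrow> poly_fun (f u)" using poly_fun_nondeg_eqs by blast
    show "\<And>c. (\<And>f. f \<in> nondeg_eqs \<Longrightarrow> (\<Sum>u\<in>UNIV. f u (\<lambda>(a, i, j). C0 a i j) * c u) = 0) \<Longrightarrow> \<forall>u\<in>UNIV. c u = 0"
      using assms(3)[unfolded nondeg_iff_eqs] by blast
  qed simp
  then obtain P where P: "poly_fun P" "P (\<lambda>(a, i, j). C0 a i j) \<noteq> 0"
    "\<And>x :: 'm \<times> 'n \<times> 'n \<Rightarrow> 'k. P x \<noteq> 0 \<Longrightarrow>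
    (\<forall>c. (\<forall>f\<in>nondeg_eqs. (\<Sum>u\<in>UNIV. f u x * c u) = 0) \<longrightarrow> (\<forall>u\<in>UNIV. c u = 0))" by blast
  have "rigid C" if "P (\<lambda>(a, i, j). C a i j) \<noteq> 0" for C
    by (rule rigid_if_nondeg) (unfold nondeg_iff_eqs, rule P(3)[OF that])
  then show ?thesis unfolding generic_def using P(1,2) assms by blast
qed

section \<open>A nondegenerate bracket\<close>

text \<open>
  Here \<open>f i j l\<close> is the \<open>l\<close>-th coordinate of \<open>F(e_i,e_j)\<close> and \<open>T c i j k\<close> is component \<open>c\<close> of
  \<open>[F(e_i,e_j),e_k]\<close>, with \<open>c = 0, 1\<close> for the even and odd edges of the path and \<open>c = 2\<close> for the
  edge between its ends.  The radicals of the three forms make everything at the ends of the path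
  vanish, and the vanishing propagates along the edges.
\<close>
lemma alternating_path_vanishing:
  fixes f :: "nat \<Rightarrow> nat \<Rightarrow> nat \<Rightarrow> 'k::field" and T :: "nat \<Rightarrow> nat \<Rightarrow> nat \<Rightarrow> nat \<Rightarrow> 'k"
  assumes n: "3 \<le> n"
    and sym12: "\<And>c i j k. T c i j k = T c j i k"
    and sym23: "\<And>c i j k. T c i j k = T c i k j"
    and fwd: "\<And>i j l. Suc l < n \<Longrightarrow> T (l mod 2) i j l = - f i j (Suc l)"
    and bwd: "\<And>i j l. Suc l < n \<Longrightarrow> T (l mod 2) i j (Suc l) = f i j l"
    and first: "\<And>i j. T 1 i j 0 = 0"
    and last: "\<And>i j. T ((n - 1) mod 2) i j (n - 1) = 0"
    and c0: "\<And>i j. T 2 i j 0 = - f i j (n - 1)"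
    and cn: "\<And>i j. T 2 i j (n - 1) = f i j 0"
    and cz: "\<And>i j k. 0 < k \<Longrightarrow> k < n - 1 \<Longrightarrow> T 2 i j k = 0"
    and Tz: "\<And>c i j k. (\<And>m. m < n \<Longrightarrow> f i j m = 0) \<Longrightarrow> T c i j k = 0"
    and ijl: "i < n" "j < n" "l < n"
  shows "f i j l = 0"
proof -
  define e where "e = n - 1"
  have e: "2 \<le> e" "n = Suc e" using n by (auto simp: e_def)
  \<comment> \<open>An interior vertex \<open>m\<close> has one path edge of each colour; its
    neighbour \<open>k\<close> along colour \<open>c\<close> satisfies
    \<open>T c i j k = f i j m\<close> up to sign.\<close>
  have partner: "\<exists>k<n. \<forall>i j. T c i j k = 0 \<longrightarrow> f i j m = 0" if m: "0 < m" "m < e" and c: "c < 2" for m c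
  proof (cases "m mod 2 = c")
    case True
    then show ?thesis using bwd[of m] that e by (intro exI[of _ "Suc m"]) auto
  next
    case False
    obtain l where l: "m = Suc l" using m(1) gr0_implies_Suc by blast
    then have "l mod 2 = c" using False c by presburger
    then show ?thesis using fwd[of l] m e l by (intro exI[of _ l]) auto
  qed
  \<comment> \<open>Vertex 0 meets no odd edge, so by symmetry \<open>T 1 0 j k = 0\<close> for all
    \<open>k\<close>. At the other end \<open>e\<close> the missing colour is
    \<open>e mod 2\<close>.\<close>
  have inner0: "f 0 j m = 0" if m: "0 < m" "m < e" for j m
  proof -
    obtain k where "\<And>i j. T 1 i j k = 0 \<Longrightarrow> f i j m = 0" using partner[OF m, of 1] by auto
    moreover have "T 1 0 j k = 0" using first sym12 sym23 by metis
    ultimately show ?thesis by blast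
  qed
  have innere: "f e j m = 0" if m: "0 < m" "m < e" for j m
  proof -
    obtain k where "\<And>i j. T (e mod 2) i j k = 0 \<Longrightarrow> f i j m = 0" using partner[OF m, of "e mod 2"] by auto
    moreover have "T (e mod 2) e j k = 0" using last sym12 sym23 unfolding e_def by metis
    ultimately show ?thesis by blast
  qed
  \<comment> \<open>Interior vertices lie in the radical of the third form, which reads off the
    components 0 and \<open>e\<close>.\<close>
  have outer: "f k j 0 = 0" "f k j e = 0" "f j k 0 = 0" "f j k e = 0" if k: "0 < k" "k < e" for j k
  proof -
    have "T 2 k j x = 0" "T 2 j k x = 0" for x using cz[of k] k sym12 sym23 unfolding e_def by metis+
    then show "f k j 0 = 0" "f k j e = 0" "f j k 0 = 0" "f j k e = 0"
      using c0 cn unfolding e_def by (metis neg_equal_0_iff_equal)+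
  qed
  have A1: "T 0 i j 1 = f i j 0" and A0: "T 0 i j 0 = - f i j 1" for i j
    using fwd[of 0] bwd[of 0] e by auto
  obtain d where d: "e = Suc d" "0 < d" using e by (cases e) auto
  have Bd: "T (d mod 2) i j d = - f i j e" and Be: "T (d mod 2) i j e = f i j d" for i j
    using fwd[of d] bwd[of d] e d by auto
  have end0: "f i j 0 = 0" if i: "i = 0 \<or> i = e" and j: "j = 0 \<or> j = e" for i j
  proof -
    have z: "f i 1 0 = 0" "f i 1 1 = 0" if "i = 0 \<or> i = e" for i
      using inner0[of 1] innere[of 1] outer[of 1] that e by auto
    consider "j = 0" | "i = 0" | "i = e" "j = e" using i j by blast
    then show ?thesis
    proof cases
      case 1
      \<comment> \<open>Symmetry of \<open>T\<close> moves the neighbour 1 of vertex 0 into an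
        argument of \<open>F\<close>, where the previous facts apply.\<close>
      have "f i j 0 = T 0 i 1 j" using A1 sym23 by metis
      also have "\<dots> = 0" using 1 A0 z i by simp
      finally show ?thesis .
    next
      case 2
      have "f i j 0 = T 0 j 1 i" using A1 sym23 sym12 by metis
      also have "\<dots> = 0" using 2 A0 z j by simp
      finally show ?thesis .
    next
      case 3
      have "f i j 0 = T 0 i 1 e" using A1 sym23 3 by metis
      \<comment> \<open>By parity, vertex \<open>e\<close> either misses colour 0 or has its last
        edge, joining it to \<open>d\<close>, in that colour.\<close>
      also have "\<dots> = 0"
      proof (cases "even e")
        case True
        then show ?thesis using last[of i 1] unfolding e_def[symmetric] by simp
      next
        case False
        then have "d mod 2 = 0" using d by presburger
        then show ?thesis using Be[of i 1] innere[of d] d 3 by simp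
      qed
      finally show ?thesis .
    qed
  qed
  have ende: "f i j e = 0" if i: "i = 0 \<or> i = e" and j: "j = 0 \<or> j = e" for i j
  proof -
    have z: "f i d d = 0" if "i = 0 \<or> i = e" for i
      using inner0[of d] innere[of d] that d by auto
    consider "j = e" | "i = e" | "i = 0" "j = 0" using i j by blast
    then show ?thesis
    proof cases
      case 1
      have "f i j e = - T (d mod 2) i d j" using Bd sym23 by (metis minus_minus)
      also have "\<dots> = 0" using 1 Be z i by simp
      finally show ?thesis .
    next
      case 2
      have "f i j e = - T (d mod 2) j d i" using Bd sym23 sym12 by (metis minus_minus)
      also have "\<dots> = 0" using 2 Be z j by simp
      finally show ?thesis .
    next
      case 3
      have "f i j e = - T (d mod 2) 0 d 0" using Bd sym23 3 by (metis minus_minus)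
      also have "\<dots> = 0"
      proof (cases "even d")
        case True
        then show ?thesis using A0[of 0 d] inner0[of 1 d] e by simp
      next
        case False
        then have "d mod 2 = 1" by presburger
        then show ?thesis using first by simp
      qed
      finally show ?thesis .
    qed
  qed
  have comp0: "f i j 0 = 0" and compe: "f i j e = 0" if "i < n" "j < n" for i j
    using that e outer end0 ende by (metis less_Suc_eq not_gr_zero)+
  \<comment> \<open>Propagation along the edge from \<open>l\<close> to \<open>Suc l\<close>:
    vanishing of \<open>F(e_l,e_j)\<close> kills component \<open>Suc l\<close> of every value, and
    vanishing of component \<open>l\<close> kills \<open>F(e_{l+1},e_j)\<close>.\<close>
  have "(\<forall>i j. i < n \<longrightarrow> j < n \<longrightarrow> f i j l = 0) \<and> (\<forall>j m. j < n \<longrightarrow> m < n \<longrightarrow> f l j m = 0)" if "l < n" for l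
    using that
  proof (induction l)
    case 0
    have "f 0 j m = 0" if "j < n" "m < n" for j m
      using that e inner0 comp0[of 0 j] compe[of 0 j] by (metis less_Suc_eq not_gr_zero zero_less_Suc)
    then show ?case using comp0 by blast
  next
    case (Suc l)
    then have IH: "\<And>i j. i < n \<Longrightarrow> j < n \<Longrightarrow> f i j l = 0" "\<And>j m. j < n \<Longrightarrow> m < n \<Longrightarrow> f l j m = 0"
      by auto
    have "f i j (Suc l) = 0" if "i < n" "j < n" for i j
    proof -
      have "f i j (Suc l) = - T (l mod 2) l j i"
        using fwd[OF Suc.prems, of i j] sym12 sym23 by (metis minus_minus)
      also have "T (l mod 2) l j i = 0" by (rule Tz) (use IH that in auto)
      finally show ?thesis by simp
    qed
    moreover have "f (Suc l) j m = 0" if jm: "j < n" "m < n" for j m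
    proof -
      consider "m = 0" | "m = e" | "0 < m" "m < e" using jm e by linarith
      then show ?thesis
      proof cases
        case 3
        then obtain k where k: "k < n" "\<And>i j. T (l mod 2) i j k = 0 \<Longrightarrow> f i j m = 0"
          using partner[of m "l mod 2"] by auto
        have "T (l mod 2) (Suc l) j k = T (l mod 2) j k (Suc l)" using sym12 sym23 by metis
        also have "\<dots> = 0" using bwd[OF Suc.prems, of j k] IH(1)[OF jm(1) k(1)] by simp
        finally show ?thesis by (rule k(2))
      qed (use comp0 compe jm Suc.prems in auto)
    qed
    ultimately show ?case by blast
  qed
  then show ?thesis using ijl by blast
qed

section \<open>Skew forms given by sets of edges\<close>

definition skewform :: "(nat \<times> nat) set \<Rightarrow> nat \<Rightarrow> nat \<Rightarrow> 'k::field" where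
  "skewform D p q = of_bool ((p, q) \<in> D) - of_bool ((q, p) \<in> D)"

definition path_edges :: "nat \<Rightarrow> nat \<Rightarrow> (nat \<times> nat) set" where
  "path_edges n c = {(p, q). q = Suc p \<and> q < n \<and> p mod 2 = c}"

lemma sum_skewform:
  fixes g :: "nat \<Rightarrow> 'k::field"
  assumes "D \<subseteq> {(p, q). p < q \<and> q < n}" "k < n"
  shows "(\<Sum>y<n. skewform D y k * g y) = (\<Sum>y | (y, k) \<in> D. g y) - (\<Sum>y | (k, y) \<in> D. g y)"
proof -
  have "(\<Sum>y<n. of_bool (P y) * g y) = (\<Sum>y | P y. g y)" if "\<And>y. P y \<Longrightarrow> y < n" for P
    by (rule sum.mono_neutral_cong_right) (use that in auto)
  then show ?thesis using assms
    by (subst (1 2) \<open>\<And>P. (\<And>y. P y \<Longrightarrow> y < n) \<Longrightarrow> (\<Sum>y<n. of_bool (P y) * g y) = (\<Sum>y | P y. g y)\<close>[symmetric])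
      (auto simp: skewform_def algebra_simps sum_subtractf)
qed

text \<open>In each of the three edge sets a vertex has at most one neighbour, so every bracket sum
  collapses to a signed coordinate of \<open>F\<close> or to zero.\<close>

lemma nondeg_alternating_path:
  fixes r :: "'n::finite \<Rightarrow> nat" and D :: "'m \<Rightarrow> (nat \<times> nat) set"
  defines "n \<equiv> CARD('n)"
  assumes r: "bij_betw r UNIV {..<n}" and n: "3 \<le> n"
    and D: "D a = path_edges n 0" "D b = path_edges n 1" "D c = {(0, n - 1)}"
  shows "nondeg (\<lambda>x i j. skewform (D x) (r i) (r j) :: 'k::field)"
  unfolding nondeg_def
proof (intro allI impI)
  fix F :: "'n \<Rightarrow> 'n \<Rightarrow> 'n \<Rightarrow> 'k" and i j l
  let ?C = "\<lambda>x i j. skewform (D x) (r i) (r j) :: 'k"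
  assume sym: "\<forall>i j l. F i j l = F j i l"
    and br: "\<forall>x i j k. (\<Sum>l\<in>UNIV. ?C x l k * F i j l) = (\<Sum>l\<in>UNIV. ?C x l j * F i k l)"
  define h where "h = the_inv_into UNIV r"
  have hr: "h (r x) = x" for x
    using r unfolding h_def by (intro the_inv_into_f_f) (auto simp: bij_betw_def)
  have rh: "r (h p) = p" if "p < n" for p
    using r that unfolding h_def by (intro f_the_inv_into_f) (auto simp: bij_betw_def)
  define f where "f i j l = F (h i) (h j) (h l)" for i j l
  define col where "col t = (if t = 0 then a else if t = 1 then b else c)" for t :: nat
  define T where "T t i j k = (\<Sum>l\<in>UNIV. ?C (col t) l (h k) * F (h i) (h j) l)" for t i j k
  have T: "T t i j k = (\<Sum>y<n. skewform (D (col t)) y k * f i j y)" if "k < n" for t i j k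
  proof -
    have "T t i j k = (\<Sum>l\<in>UNIV. skewform (D (col t)) (r l) k * f i j (r l))"
      unfolding T_def f_def hr rh[OF that] ..
    also have "\<dots> = (\<Sum>y<n. skewform (D (col t)) y k * f i j y)"
      by (rule sum.reindex_bij_betw[OF r])
    finally show ?thesis .
  qed
  have Dcol: "D (col 0) = path_edges n 0" "D (col 1) = path_edges n 1" "D (col 2) = {(0, n - 1)}"
    "D (col (Suc 0)) = path_edges n 1"
    using D by (auto simp: col_def)
  have Dpath: "D (col (p mod 2)) = path_edges n (p mod 2)" for p
    using Dcol by (cases "even p") (auto simp: even_iff_mod_2_eq_zero odd_iff_mod_2_eq_one)
  have sub: "path_edges n t \<subseteq> {(p, q). p < q \<and> q < n}" for t by (auto simp: path_edges_def)
  have subc: "{(0, n - 1)} \<subseteq> {(p, q). p < q \<and> q < n}" using n by auto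
  have pred: "{y. (y, k) \<in> path_edges n t} = (if \<exists>p. k = Suc p \<and> p mod 2 = t \<and> k < n then {k - 1} else {})"
    and succ: "{y. (k, y) \<in> path_edges n t} = (if Suc k < n \<and> k mod 2 = t then {Suc k} else {})" for k t
    by (auto simp: path_edges_def)
  have "f i j l = 0" if "i < n" "j < n" "l < n" for i j l
  proof (rule alternating_path_vanishing[where f = f and T = T and n = n])
    show "T t i j k = T t j i k" for t i j k using sym by (simp add: T_def)
    show "T t i j k = T t i k j" for t i j k unfolding T_def by (rule br[rule_format])
    show "T (l mod 2) i j l = - f i j (Suc l)" if l: "Suc l < n" for i j l
    proof -
      have "{y. (y, l) \<in> path_edges n (l mod 2)} = {}" by (auto simp: pred; presburger)
      then show ?thesis using l by (simp add: T Dpath sum_skewform[OF sub] succ)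
    qed
    show "T (l mod 2) i j (Suc l) = f i j l" if l: "Suc l < n" for i j l
    proof -
      have "{y. (Suc l, y) \<in> path_edges n (l mod 2)} = {}" by (auto simp: succ; presburger)
      then show ?thesis using l by (simp add: T Dpath sum_skewform[OF sub] pred)
    qed
    show "T 1 i j 0 = 0" for i j
      using n by (simp add: T Dcol sum_skewform[OF sub] succ pred)
    show "T ((n - 1) mod 2) i j (n - 1) = 0" for i j
    proof -
      have "{y. (y, n - 1) \<in> path_edges n ((n - 1) mod 2)} = {}" by (auto simp: pred; presburger)
      then show ?thesis using n by (simp add: T Dpath sum_skewform[OF sub] succ)
    qed
    have 0: "{y. (y, k) \<in> {(0, n - 1)}} = (if k = n - 1 then {0} else {})"
      "{y. (k, y) \<in> {(0, n - 1)}} = (if k = 0 then {n - 1} else {})" for k by auto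
    show "T 2 i j 0 = - f i j (n - 1)" "T 2 i j (n - 1) = f i j 0" for i j
      using n by (simp_all only: T Dcol sum_skewform[OF subc] 0) auto
    show "T 2 i j k = 0" if "0 < k" "k < n - 1" for i j k
    proof -
      have "k < n" using that by linarith
      then show ?thesis using that by (simp only: T Dcol sum_skewform[OF subc] 0) simp
    qed
    show "T t i j k = 0" if "\<And>m. m < n \<Longrightarrow> f i j m = 0" for t i j k
    proof -
      have "F (h i) (h j) x = 0" for x
        using that[of "r x"] r by (auto simp: f_def hr bij_betw_def)
      then show ?thesis by (simp add: T_def)
    qed
  qed (use n that in auto)
  from this[of "r i" "r j" "r l"] show "F i j l = 0"
    using r by (auto simp: f_def hr bij_betw_def)
qed

text \<open>The system is triangular: forms in \<open>S\<close> are single edges and are solved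
  first by \<open>\<zeta>'\<close>. Each other form is then corrected at its own edge
  \<open>d x\<close>, which lies in no other form outside \<open>S\<close> and, as \<open>d\<close>
  is injective, in none inside \<open>S\<close>.\<close>

lemma surj_edge_forms:
  fixes r :: "'n::finite \<Rightarrow> nat" and D :: "'m::finite \<Rightarrow> (nat \<times> nat) set"
  defines "n \<equiv> CARD('n)"
  assumes r: "bij_betw r UNIV {..<n}" and sub: "\<And>x. D x \<subseteq> {(p, q). p < q \<and> q < n}"
    and d: "inj d" "\<And>x. d x \<in> D x" "\<And>x. x \<in> S \<Longrightarrow> D x = {d x}"
      "\<And>x y. x \<notin> S \<Longrightarrow> y \<notin> S \<Longrightarrow> x \<noteq> y \<Longrightarrow> d y \<notin> D x"
  shows "surj_const (\<lambda>x i j. skewform (D x) (r i) (r j) :: 'k::field)"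
  unfolding surj_const_def
proof
  fix w :: "'m \<Rightarrow> 'k"
  define E where "E = {(p, q). p < q \<and> q < n}"
  have finE: "finite E" unfolding E_def by (rule finite_subset[of _ "{..<n} \<times> {..<n}"]) auto
  have finD: "finite (D x)" for x using sub finE finite_subset unfolding E_def by blast
  define \<zeta>' where "\<zeta>' e = (\<Sum>x\<in>S. if d x = e then w x else 0)" for e
  define \<zeta> where "\<zeta> e = \<zeta>' e + (\<Sum>x\<in>-S. if d x = e then w x - sum \<zeta>' (D x) else 0)" for e
  have delta: "(\<Sum>x\<in>A. if d x = d y then g x else 0) = (if y \<in> A then g y else 0)" for A y and g :: "'m \<Rightarrow> 'k"
    using d(1) by (simp add: inj_eq)
  have \<zeta>S: "sum \<zeta> (D x) = w x" if x: "x \<in> S" for x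
    using x by (simp add: d(3)[OF x] \<zeta>_def \<zeta>'_def delta)
  have \<zeta>nS: "sum \<zeta> (D x) = w x" if x: "x \<notin> S" for x
  proof -
    have "(\<Sum>e\<in>D x. \<Sum>y\<in>-S. if d y = e then w y - sum \<zeta>' (D y) else 0)
        = (\<Sum>y\<in>-S. \<Sum>e\<in>D x. if d y = e then w y - sum \<zeta>' (D y) else 0)"
      by (rule sum.swap)
    also have "\<dots> = (\<Sum>y\<in>-S. if y = x then w x - sum \<zeta>' (D x) else 0)"
      using d(2,4) x finD by (intro sum.cong) auto
    also have "\<dots> = w x - sum \<zeta>' (D x)" using x by simp
    finally show ?thesis unfolding \<zeta>_def sum.distrib by simp
  qed
  \<comment> \<open>Supporting \<open>z\<close> on increasing pairs counts each edge once and with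
    positive sign.\<close>
  define z where "z i j = (if r i < r j then \<zeta> (r i, r j) else 0)" for i j
  have "(\<Sum>i\<in>UNIV. \<Sum>j\<in>UNIV. z i j * skewform (D x) (r i) (r j)) = w x" for x
  proof -
    have Dlt: "p < q" "q < n" "p < n" if "(p, q) \<in> D x" for p q
      using subsetD[OF sub that] by auto
    have "(\<Sum>i\<in>UNIV. \<Sum>j\<in>UNIV. z i j * skewform (D x) (r i) (r j))
        = (\<Sum>i\<in>UNIV. \<Sum>q<n. (if r i < q then \<zeta> (r i, q) else 0) * skewform (D x) (r i) q)"
      unfolding z_def by (rule sum.cong[OF refl], rule sum.reindex_bij_betw[OF r])
    also have "\<dots> = (\<Sum>p<n. \<Sum>q<n. (if p < q then \<zeta> (p, q) else 0) * skewform (D x) p q)"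
      by (rule sum.reindex_bij_betw[OF r])
    also have "\<dots> = (\<Sum>(p, q)\<in>{..<n} \<times> {..<n}. (if p < q then \<zeta> (p, q) else 0) * skewform (D x) p q)"
      by (rule sum.cartesian_product)
    also have "\<dots> = sum \<zeta> (D x)"
    proof (rule sum.mono_neutral_cong_right)
      have *: "(q, p) \<notin> D x" if "p < q" for p q
        using Dlt(1)[of q p] that by auto
      show "D x \<subseteq> {..<n} \<times> {..<n}" using Dlt by auto
      show "\<forall>e\<in>{..<n} \<times> {..<n} - D x. (case e of (p, q) \<Rightarrow> (if p < q then \<zeta> (p, q) else 0) * skewform (D x) p q) = 0"
        using * by (auto simp: skewform_def)
      show "(case e of (p, q) \<Rightarrow> (if p < q then \<zeta> (p, q) else 0) * skewform (D x) p q) = \<zeta> e" if "e \<in> D x" for e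
        using that Dlt(1) * by (cases e) (simp add: skewform_def)
    qed simp
    also have "\<dots> = w x" using \<zeta>S \<zeta>nS by blast
    finally show ?thesis .
  qed
  then show "\<exists>z. \<forall>a. (\<Sum>i\<in>UNIV. \<Sum>j\<in>UNIV. z i j * skewform (D a) (r i) (r j)) = w a" by blast
qed

section \<open>Choosing the edges of the example\<close>

lemma card_ordered_pairs: "card {(p, q). p < q \<and> q < n} = n choose 2"
proof -
  have "{(p, q). p < q \<and> q < n} = prod.swap ` (SIGMA q:{..<n}. {..<q})" by force
  then have "card {(p, q). p < q \<and> q < n} = (\<Sum>q<n. q)" by (simp add: card_image)
  also have "\<dots> = n choose 2" by (induction n) (auto simp: numeral_2_eq_2)
  finally show ?thesis .
qed

lemma generic_rigid:
  assumes "CARD('n) \<ge> 3" and m: "CARD('m) \<ge> 3" "CARD('m) \<le> CARD('n) choose 2"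
  shows "generic (rigid :: ('m::finite \<Rightarrow> 'n::finite \<Rightarrow> 'n \<Rightarrow> 'k::field_char_0) \<Rightarrow> bool)"
proof -
  define n where "n = CARD('n)"
  define E where "E = {(p, q). p < q \<and> q < n}"
  have n3: "3 \<le> n" using assms by (simp add: n_def)
  have finE: "finite E" unfolding E_def by (rule finite_subset[of _ "{..<n} \<times> {..<n}"]) auto
  obtain r :: "'n \<Rightarrow> nat" where r: "bij_betw r UNIV {..<n}"
    using ex_bij_betw_finite_nat[of "UNIV :: 'n set"] by (auto simp: n_def atLeast0LessThan)
  obtain M :: "'m set" where "card M = 3" using obtain_subset_with_card_n[OF m(1)] by metis
  then obtain a b c :: 'm where abc: "a \<noteq> b" "a \<noteq> c" "b \<noteq> c" by (auto simp: card_3_iff)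
  \<comment> \<open>These are the representative edges of the three special components. The bound
    \<open>CARD('m) \<le> CARD('n) choose 2\<close> leaves enough other edges for the remaining
    components.\<close>
  let ?X = "{(0, 1), (1, 2), (0, n - 1)} :: (nat \<times> nat) set"
  have "card (- {a, b, c}) = CARD('m) - 3" using abc by (simp add: Compl_eq_Diff_UNIV card_Diff_subset)
  also have "\<dots> \<le> card E - card ?X"
  proof -
    have "card ?X \<le> 3" by (simp add: card_insert_if)
    then show ?thesis using m card_ordered_pairs[of n] unfolding E_def n_def by linarith
  qed
  also have "\<dots> = card (E - ?X)" using n3 by (intro card_Diff_subset[symmetric]) (auto simp: E_def)
  finally obtain g where g: "inj_on g (- {a, b, c})" "g ` (- {a, b, c}) \<subseteq> E - ?X"
    using card_le_inj[of "- {a, b, c}" "E - ?X"] finE by auto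
  define d where "d x = (if x = a then (0, 1) else if x = b then (1, 2) else if x = c then (0, n - 1) else g x)" for x
  define D where "D x = (if x = a then path_edges n 0 else if x = b then path_edges n 1 else {d x})" for x
  have gE: "g x \<in> E - ?X" if "x \<notin> {a, b, c}" for x using g(2) that by blast
  have "inj d"
  proof (rule injI)
    fix x y assume "d x = d y"
    then show "x = y"
      using gE[of x] gE[of y] inj_onD[OF g(1), of x y] n3 unfolding d_def by (auto split: if_splits)
  qed
  have dE: "d x \<in> E" for x using gE[of x] n3 by (auto simp: d_def E_def)
  have "D x \<subseteq> {(p, q). p < q \<and> q < n}" for x
    using dE[of x] by (auto simp: D_def E_def path_edges_def)
  then have surj: "surj_const (\<lambda>x i j. skewform (D x) (r i) (r j) :: 'k)"
    using \<open>inj d\<close> r n3 abc unfolding n_def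
    by (intro surj_edge_forms[where d = d and S = "- {a, b}"])
      (auto simp: D_def d_def path_edges_def n_def)
  have nondeg: "nondeg (\<lambda>x i j. skewform (D x) (r i) (r j) :: 'k)"
    using r n3 abc unfolding n_def
    by (intro nondeg_alternating_path[where a = a and b = b and c = c]) (auto simp: D_def d_def n_def)
  have "skew_const (\<lambda>x i j. skewform (D x) (r i) (r j) :: 'k)"
    by (simp add: skew_const_def skewform_def)
  then show ?thesis using surj nondeg by (rule generic_rigid_if_nondeg)
qed

theorem theorem5p1:
  assumes "CARD('n) \<ge> 3" and "CARD('m) \<ge> 3"
    and "CARD('m) \<le> CARD('n) choose 2"
  shows "generic (rigid :: ('m::finite \<Rightarrow> 'n::finite \<Rightarrow> 'n \<Rightarrow> real) \<Rightarrow> bool)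
       \<and> generic (rigid :: ('m \<Rightarrow> 'n \<Rightarrow> 'n \<Rightarrow> complex) \<Rightarrow> bool)"
  using generic_rigid[OF assms] generic_rigid[OF assms] by blast

end
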